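(* Let $X\to\mathbb{P}^1$ be a Harbater–Katz–Gabber cover with Galois group a $p$-group over an algebraically closed field $\mathbf{k}$ of characteristic $p>0$, with the data and notation fixed in the context. Let $1\le i\le k$ and let $\bar v=(v_0,\dots,v_k)\in\mathbb{N}^{k+1}$. For $0\le\nu\le n_i$ and $\bar\lambda=(\ell_0,\dots,\ell_{i-1})\in\Lambda_i$ set $$\bar\gamma_{\bar v,i,\nu}=(v_0,\dots,v_{i-1},v_i+p^{n_i-\nu},v_{i+1},\dots,v_k),\qquad \bar\beta_{\bar v,i,\bar\lambda}=(\ell_0,\dots,\ell_{i-1},0,\dots,0)+\bar v .$$ Suppose that $\|\bar\gamma_{\bar v,i,0}\|\le 4g-4$ and that all the tuples $\bar\gamma_{\bar v,i,\nu}$ ($0\le \nu\le n_i$) and all $\bar\beta_{\bar v,i,\bar\lambda}$ with $a^{(i)}_{\bar\lambda}\ne0$ lie in $\mathbf{A}+\mathbf{A}$. Then the element $$G_{\bar v,i}=\omega^{\otimes2}_{\bar\gamma_{\bar v,i,0}}+\sum_{\nu=1}^{n_i}a^{(i)}_{n_i-\nu}\,\omega^{\otimes 2}_{\bar\gamma_{\bar v,i,\nu}}-\sum_{\bar\lambda\in\Lambda_i,\ \|\bar\lambda\|\le p^{n_i}\bar m_i}a^{(i)}_{\bar\lambda}\,\omega^{\otimes 2}_{\bar\beta_{\bar v,i,\bar\lambda}}\ \in\ \mathrm{Sym}\,H^0(X,\Omega_X)$$ (terms with zero coefficient omitted) is contained in the canonical ideal, i.e. in the kernel of the canonical map $\phi:\mathrm{Sym}\,H^0(X,\Omega_X)\to\bigoplus_{n\ge0}H^0(X,\Omega_X^{\otimes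 n})$.
   Context: $\mathbf{k}$ is an algebraically closed field of characteristic $p>0$; $\mathbb{N}$ contains $0$. A Harbater–Katz–Gabber (HKG) cover with $p$-group is a Galois cover $X\to\mathbb{P}^1$ of smooth projective curves over $\mathbf{k}$ with Galois group a $p$-group, having a unique ramified point $P\in X$, which is totally (and wildly) ramified. Let $g$ be the genus of $X$, $F$ its function field, $G_0=G_0(P)=G_1(P)$ the (lower numbering) ramification group at $P$, and $b_1<\dots<b_k$ the lower ramification jumps at $P$, all prime to $p$. It is known that there is a tower $F_1=F^{G_1(P)}=\mathbf{k}(\bar f_0)\subset F_2\subset\cdots\subset F_{k+1}=F$ with $F_{i+1}=F_i(\bar f_i)$, $[F_{i+1}:F_i]=p^{n_i}$ for $1\le i\le k$, $|G_0|=p^{n_1+\cdots+n_k}$, such that, as functions on $X$: $\bar f_0$ has a pole only at $P$, of order $|G_0|$; $\bar f_i$ ($1\le i\le k$) has a pole only at $P$, of order $\bar m_i:=p^{n_{i+1}+\cdots+n_k}b_i$; and the irreducible polynomial of $\bar f_i$ over $F_i$ is $$X^{p^{n_i}}+a^{(i)}_{n_i-1}X^{p^{n_i-1}}+\cdots+a^{(i)}_0X-D_i,\qquad a^{(i)}_j\in\mathbf{k},\ D_i\in F_i,$$ where $D_i$ has valuation $-p^{n_i}\bar m_i$ at $P$ (in $F$). Write $$D_i=\sum_{\bar\lambda=(\ell_0,\dots,\ell_{i-1})\in\Lambda_i}a^{(i)}_{\bar\lambda}\,\bar f_0^{\ell_0}\cdots\bar f_{i-1}^{\ell_{i-1}},\quad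 a^{(i)}_{\bar\lambda}\in\mathbf{k},\qquad \Lambda_i=\{(\ell_0,\dots,\ell_{i-1})\in\mathbb{N}^i:\ 0\le\ell_\nu<p^{n_\nu}\text{ for }1\le\nu\le i-1\}.$$ All monomials occurring in $D_i$ with non-zero coefficient satisfy $\|\bar\lambda\|\le p^{n_i}\bar m_i$. For $\bar h=(i_0,\dots,i_k)\in\mathbb{N}^{k+1}$ put $\|\bar h\|=i_0|G_0|+\sum_{\nu=1}^k i_\nu\bar m_\nu$ and $f_{\bar h}=\bar f_0^{i_0}\cdots\bar f_k^{i_k}$; tuples in $\mathbb{N}^i$ are regarded as elements of $\mathbb{N}^{k+1}$ by appending zeros. Let $\mathbf{A}=\{\bar h\in\mathbb{N}^{k+1}:\|\bar h\|\le 2g-2\}$ and $\mathbf{A}+\mathbf{A}=\{L+K:L,K\in\mathbf{A}\}$. For $L\in\mathbf{A}$ let $\omega_L=f_L\,d\bar f_0\in H^0(X,\Omega_X)$. For $u\in\mathbf{A}+\mathbf{A}$, $\omega_u^{\otimes 2}$ denotes the degree-two element $\omega_L\omega_K$ of $\mathrm{Sym}\,H^0(X,\Omega_X)$ for any chosen $L,K\in\mathbf{A}$ with $L+K=u$ (the choice does not matter modulo the canonical ideal). The canonical map $\phi$ is the natural multiplication map. *)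

theory Defs
  imports
    "HOL-Algebra.Algebra"
    "HOL-Algebra.Algebraic_Closure_Type"
    "HOL-Computational_Algebra.Computational_Algebra"
    "HOL-Library.Poly_Mapping"
begin

text \<open>
  A smooth projective curve \<open>X\<close> over the algebraically closed field \<open>'k\<close> is given by its function
  field: a field \<open>'f\<close> together with an embedding \<open>emb\<close> of \<open>'k\<close>.  The closed points of \<open>X\<close> are the
  normalised discrete valuations of \<open>'f\<close> that are trivial on \<open>'k\<close>.
\<close>

section \<open>Points, rings of regular functions, Galois groups\<close>

abbreviation ring_of :: "'a::ring_1 itself \<Rightarrow> 'a ring" where
  "ring_of _ \<equiv> ring_of_type_algebra"

text \<open>The value at \<open>0\<close> is fixed to \<open>0\<close>, so that a point determines the function \<open>Q\<close> uniquely;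
  \<open>val_ge\<close> restores the convention that \<open>0\<close> has valuation \<open>\<infinity>\<close>.\<close>

definition place :: "('k::field \<Rightarrow> 'f::field) \<Rightarrow> ('f \<Rightarrow> int) \<Rightarrow> bool" where
  "place emb Q \<longleftrightarrow>
     Q 0 = 0 \<and>
     (\<forall>x y. x \<noteq> 0 \<longrightarrow> y \<noteq> 0 \<longrightarrow> Q (x * y) = Q x + Q y) \<and>
     (\<forall>x y. x \<noteq> 0 \<longrightarrow> y \<noteq> 0 \<longrightarrow> x + y \<noteq> 0 \<longrightarrow> min (Q x) (Q y) \<le> Q (x + y)) \<and>
     (\<forall>c. Q (emb c) = 0) \<and>
     (\<exists>x. Q x = 1)"

definition val_ge :: "('f::field \<Rightarrow> int) \<Rightarrow> 'f \<Rightarrow> int \<Rightarrow> bool" where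
  "val_ge Q x m \<longleftrightarrow> x = 0 \<or> m \<le> Q x"

definition local_ring :: "('f::field \<Rightarrow> int) \<Rightarrow> 'f set" where
  "local_ring Q = {x. val_ge Q x 0}"

definition pole_only_at ::
    "('k::field \<Rightarrow> 'f::field) \<Rightarrow> ('f \<Rightarrow> int) \<Rightarrow> 'f \<Rightarrow> nat \<Rightarrow> bool" where
  "pole_only_at emb P x m \<longleftrightarrow>
     x \<noteq> 0 \<and> P x = - int m \<and> (\<forall>Q. place emb Q \<longrightarrow> Q \<noteq> P \<longrightarrow> x \<in> local_ring Q)"

definition transcendental_over :: "('k::field \<Rightarrow> 'f::field) \<Rightarrow> 'f \<Rightarrow> bool" where
  "transcendental_over emb x \<longleftrightarrow> (\<forall>q. q \<noteq> 0 \<longrightarrow> poly (map_poly emb q) x \<noteq> 0)"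

definition adjoin :: "'f::field set \<Rightarrow> 'f \<Rightarrow> 'f set" where
  "adjoin E x = generate_field (ring_of TYPE('f)) (E \<union> {x})"

definition ext_degree :: "'f::field set \<Rightarrow> 'f set \<Rightarrow> nat \<Rightarrow> bool" where
  "ext_degree E L n \<longleftrightarrow> ring.dimension (ring_of TYPE('f)) n E L"

definition gal_group :: "'f::field set \<Rightarrow> ('f \<Rightarrow> 'f) set" where
  "gal_group E =
     {\<sigma> \<in> ring_iso (ring_of TYPE('f)) (ring_of TYPE('f)). \<forall>x\<in>E. \<sigma> x = x}"

definition fixed_field :: "('f::field \<Rightarrow> 'f) set \<Rightarrow> 'f set" where
  "fixed_field S = {x. \<forall>\<sigma>\<in>S. \<sigma> x = x}"

text \<open>The positive generator of the value group of \<open>E\<close>.  Residue fields are all equal to \<open>'k\<close>,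
  so a point is ramified over \<open>E\<close> iff this index exceeds \<open>1\<close>.\<close>

definition ram_index :: "'f::field set \<Rightarrow> ('f \<Rightarrow> int) \<Rightarrow> nat" where
  "ram_index E Q = (LEAST e. 0 < e \<and> (\<exists>x\<in>E. x \<noteq> 0 \<and> Q x = int e))"

definition ram_group :: "'f::field set \<Rightarrow> ('f \<Rightarrow> int) \<Rightarrow> nat \<Rightarrow> ('f \<Rightarrow> 'f) set" where
  "ram_group E P j =
     {\<sigma> \<in> gal_group E. \<forall>x\<in>local_ring P. val_ge P (\<sigma> x - x) (int j + 1)}"

definition irreducible_over :: "'f::field set \<Rightarrow> 'f poly \<Rightarrow> bool" where
  "irreducible_over E q \<longleftrightarrow>
     0 < Polynomial.degree q \<and> (\<forall>j. poly.coeff q j \<in> E) \<and>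
     (\<forall>r s. (\<forall>j. poly.coeff r j \<in> E) \<longrightarrow> (\<forall>j. poly.coeff s j \<in> E) \<longrightarrow> q = r * s \<longrightarrow>
        Polynomial.degree r = 0 \<or> Polynomial.degree s = 0)"

text \<open>\<open>E\<close> is the function field of the projective line, embedded in \<open>'f\<close> by the covering map.\<close>

locale hkg_cover =
  fixes emb :: "'k::alg_closed_field \<Rightarrow> 'f::field"
    and E :: "'f set"
    and P :: "'f \<Rightarrow> int"
  assumes char_pos: "0 < CHAR('k)"
    and emb_hom: "emb \<in> ring_hom (ring_of TYPE('k)) (ring_of TYPE('f))"
    and base_rational: "\<exists>x. transcendental_over emb x \<and> E = adjoin (range emb) x"
    and finite_ext: "\<exists>m. ext_degree E UNIV m"
    and galois: "fixed_field (gal_group E) = E"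
    and p_group: "\<exists>m. card (gal_group E) = CHAR('k) ^ m"
    and unique_ramified: "{Q. place emb Q \<and> 1 < ram_index E Q} = {P}"
    and totally_ramified: "ram_index E P = card (gal_group E)"


section \<open>Differentials\<close>

text \<open>
  \<open>('w, smul, d)\<close> is the module of Kaehler differentials of \<open>'f\<close> over \<open>'k\<close>: it is presented by the
  generators \<open>d x\<close> and the relations of additivity, Leibniz rule and triviality on constants.
  An element \<open>u :: 'f \<Rightarrow>\<^sub>0 'f\<close> of the free module stands for \<open>\<Sum>x. u x \<cdot> [x]\<close>.
\<close>

definition form_of :: "('f::field \<Rightarrow> 'w::ab_group_add \<Rightarrow> 'w) \<Rightarrow> ('f \<Rightarrow> 'w) \<Rightarrow> ('f \<Rightarrow>\<^sub>0 'f) \<Rightarrow> 'w"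
  where "form_of smul d u = (\<Sum>x\<in>Poly_Mapping.keys u. smul (Poly_Mapping.lookup u x) (d x))"

definition kaehler_relations :: "('k::field \<Rightarrow> 'f::field) \<Rightarrow> ('f \<Rightarrow>\<^sub>0 'f) set" where
  "kaehler_relations emb =
     {Poly_Mapping.single (x + y) 1 - Poly_Mapping.single x 1 - Poly_Mapping.single y 1 | x y. True} \<union>
     {Poly_Mapping.single (x * y) 1 - Poly_Mapping.single y x - Poly_Mapping.single x y | x y. True} \<union>
     {Poly_Mapping.single (emb c) 1 | c. True}"

definition kaehler_module ::
    "('k::field \<Rightarrow> 'f::field) \<Rightarrow> ('f \<Rightarrow> 'w::ab_group_add \<Rightarrow> 'w) \<Rightarrow> ('f \<Rightarrow> 'w) \<Rightarrow> bool" where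
  "kaehler_module emb smul d \<longleftrightarrow>
     vector_space smul \<and>
     range (form_of smul d) = UNIV \<and>
     {u. form_of smul d u = 0} =
       module.span (\<lambda>c. Poly_Mapping.map ((*) c)) (kaehler_relations emb)"

text \<open>\<open>\<Omega>\<^sub>X\<close> has at \<open>Q\<close> the stalk generated over the local ring by the differentials of its elements.\<close>

definition regular_forms ::
    "('f::field \<Rightarrow> 'w::ab_group_add \<Rightarrow> 'w) \<Rightarrow> ('f \<Rightarrow> 'w) \<Rightarrow> ('f \<Rightarrow> int) \<Rightarrow> 'w set" where
  "regular_forms smul d Q =
     {form_of smul d u | u. \<forall>x\<in>Poly_Mapping.keys u.
        x \<in> local_ring Q \<and> Poly_Mapping.lookup u x \<in> local_ring Q}"

definition hol_forms ::
    "('k::field \<Rightarrow> 'f::field) \<Rightarrow> ('f \<Rightarrow> 'w::ab_group_add \<Rightarrow> 'w) \<Rightarrow> ('f \<Rightarrow> 'w) \<Rightarrow> 'w set" where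
  "hol_forms emb smul d = {w. \<forall>Q. place emb Q \<longrightarrow> w \<in> regular_forms smul d Q}"


section \<open>Tensor and symmetric algebras\<close>

datatype 'a fword = FWord (letters: "'a list")

instantiation fword :: (type) monoid_add
begin

definition zero_fword :: "'a fword" where
  "zero_fword = FWord []"

definition plus_fword :: "'a fword \<Rightarrow> 'a fword \<Rightarrow> 'a fword" where
  "plus_fword u v = FWord (letters u @ letters v)"

instance
  by standard (simp_all add: zero_fword_def plus_fword_def)

end

text \<open>The monoid algebra of the free monoid on \<open>V\<close>, i.e. non-commutative polynomials over \<open>'r\<close>.\<close>

definition free_algebra :: "'w set \<Rightarrow> ('w fword \<Rightarrow>\<^sub>0 'r::comm_ring_1) ring" where
  "free_algebra V =
     (ring_of TYPE('w fword \<Rightarrow>\<^sub>0 'r))\<lparr>carrier := {u. \<forall>w\<in>Poly_Mapping.keys u. set (letters w) \<subseteq> V}\<rparr>"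

abbreviation letter :: "'w \<Rightarrow> 'w fword \<Rightarrow>\<^sub>0 'r::comm_ring_1" where
  "letter x \<equiv> Poly_Mapping.single (FWord [x]) 1"

abbreviation const :: "'r::comm_ring_1 \<Rightarrow> 'w fword \<Rightarrow>\<^sub>0 'r" where
  "const c \<equiv> Poly_Mapping.single 0 c"

definition linear_relations ::
    "('r::comm_ring_1 \<Rightarrow> 'w::ab_group_add \<Rightarrow> 'w) \<Rightarrow> 'w set \<Rightarrow> ('w fword \<Rightarrow>\<^sub>0 'r) set" where
  "linear_relations smul V =
     {letter (x + y) - letter x - letter y | x y. x \<in> V \<and> y \<in> V} \<union>
     {letter (smul c x) - const c * letter x | c x. x \<in> V}"

definition commutators :: "'w set \<Rightarrow> ('w fword \<Rightarrow>\<^sub>0 'r::comm_ring_1) set" where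
  "commutators V = {letter x * letter y - letter y * letter x | x y. x \<in> V \<and> y \<in> V}"

definition tensor_ideal ::
    "('r::comm_ring_1 \<Rightarrow> 'w::ab_group_add \<Rightarrow> 'w) \<Rightarrow> 'w set \<Rightarrow> ('w fword \<Rightarrow>\<^sub>0 'r) set" where
  "tensor_ideal smul V = genideal (free_algebra V) (linear_relations smul V)"

definition tensor_algebra ::
    "('r::comm_ring_1 \<Rightarrow> 'w::ab_group_add \<Rightarrow> 'w) \<Rightarrow> 'w set \<Rightarrow> ('w fword \<Rightarrow>\<^sub>0 'r) set ring" where
  "tensor_algebra smul V = free_algebra V Quot tensor_ideal smul V"

definition sym_ideal ::
    "('r::comm_ring_1 \<Rightarrow> 'w::ab_group_add \<Rightarrow> 'w) \<Rightarrow> 'w set \<Rightarrow> ('w fword \<Rightarrow>\<^sub>0 'r) set" where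
  "sym_ideal smul V = genideal (free_algebra V) (linear_relations smul V \<union> commutators V)"

definition sym_algebra ::
    "('r::comm_ring_1 \<Rightarrow> 'w::ab_group_add \<Rightarrow> 'w) \<Rightarrow> 'w set \<Rightarrow> ('w fword \<Rightarrow>\<^sub>0 'r) set ring" where
  "sym_algebra smul V = free_algebra V Quot sym_ideal smul V"


section \<open>The canonical map\<close>

text \<open>Restriction of scalars along \<open>emb\<close>.\<close>

abbreviation ksmul :: "('k::field \<Rightarrow> 'f::field) \<Rightarrow> ('f \<Rightarrow> 'w::ab_group_add \<Rightarrow> 'w) \<Rightarrow> 'k \<Rightarrow> 'w \<Rightarrow> 'w"
  where "ksmul emb smul \<equiv> \<lambda>c. smul (emb c)"

definition sym_forms ::
    "('k::field \<Rightarrow> 'f::field) \<Rightarrow> ('f \<Rightarrow> 'w::ab_group_add \<Rightarrow> 'w) \<Rightarrow> ('f \<Rightarrow> 'w) \<Rightarrow>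
      ('w fword \<Rightarrow>\<^sub>0 'k) set ring" where
  "sym_forms emb smul d = sym_algebra (ksmul emb smul) (hol_forms emb smul d)"

definition genus ::
    "('k::field \<Rightarrow> 'f::field) \<Rightarrow> ('f \<Rightarrow> 'w::ab_group_add \<Rightarrow> 'w) \<Rightarrow> ('f \<Rightarrow> 'w) \<Rightarrow> nat" where
  "genus emb smul d = vector_space.dim (ksmul emb smul) (hol_forms emb smul d)"

text \<open>
  \<open>\<Oplus>\<^sub>n H\<^sup>0(X, \<Omega>\<^sub>X\<^sup>\<otimes>\<^sup>n)\<close> as a subring of the tensor algebra \<open>\<Oplus>\<^sub>n \<Omega>\<^sup>\<otimes>\<^sup>n\<close> over the function field.
  A tensor is regular at \<open>Q\<close> iff it is represented by a sum of terms \<open>c \<cdot> dx\<^sub>1 \<otimes> \<dots> \<otimes> dx\<^sub>n\<close> with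
  \<open>c\<close> and all \<open>x\<^sub>j\<close> regular at \<open>Q\<close>.  This condition is homogeneous: it may be checked degree by degree.
\<close>

definition regular_tensors ::
    "('f \<Rightarrow> 'w) \<Rightarrow> ('f::field \<Rightarrow> int) \<Rightarrow> ('w fword \<Rightarrow>\<^sub>0 'f) set" where
  "regular_tensors d Q =
     {u. \<forall>w\<in>Poly_Mapping.keys u.
        Poly_Mapping.lookup u w \<in> local_ring Q \<and> set (letters w) \<subseteq> d ` local_ring Q}"

definition canonical_ring ::
    "('k::field \<Rightarrow> 'f::field) \<Rightarrow> ('f \<Rightarrow> 'w::ab_group_add \<Rightarrow> 'w) \<Rightarrow> ('f \<Rightarrow> 'w) \<Rightarrow>
      ('w fword \<Rightarrow>\<^sub>0 'f) set ring" where
  "canonical_ring emb smul d =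
     (tensor_algebra smul UNIV)
       \<lparr>carrier := {C \<in> carrier (tensor_algebra smul UNIV).
                     \<forall>Q. place emb Q \<longrightarrow> C \<inter> regular_tensors d Q \<noteq> {}}\<rparr>"

text \<open>The map induced by \<open>w\<^sub>1 \<cdots> w\<^sub>n \<mapsto> w\<^sub>1 \<otimes> \<dots> \<otimes> w\<^sub>n\<close>; all representatives of a class have the same
  image because \<open>\<Omega>\<close> is one-dimensional over the function field.\<close>

definition canonical_map ::
    "('k::field \<Rightarrow> 'f::field) \<Rightarrow> ('f \<Rightarrow> 'w::ab_group_add \<Rightarrow> 'w) \<Rightarrow>
      ('w fword \<Rightarrow>\<^sub>0 'k) set \<Rightarrow> ('w fword \<Rightarrow>\<^sub>0 'f) set" where
  "canonical_map emb smul C =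
     the_elem ((\<lambda>u. tensor_ideal smul UNIV +>\<^bsub>free_algebra UNIV\<^esub> Poly_Mapping.map emb u) ` C)"

definition canonical_ideal ::
    "('k::field \<Rightarrow> 'f::field) \<Rightarrow> ('f \<Rightarrow> 'w::ab_group_add \<Rightarrow> 'w) \<Rightarrow> ('f \<Rightarrow> 'w) \<Rightarrow>
      ('w fword \<Rightarrow>\<^sub>0 'k) set set" where
  "canonical_ideal emb smul d =
     a_kernel (sym_forms emb smul d) (canonical_ring emb smul d) (canonical_map emb smul)"


section \<open>HKG covers with their tower\<close>

text \<open>
  \<open>fld i\<close> is \<open>F\<^sub>i\<close> and \<open>gen i\<close> is \<open>f\<^sub>i\<close>; \<open>acoef i j\<close> is the coefficient \<open>a\<^sub>j\<close> of the \<open>i\<close>-th additive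
  polynomial and \<open>dcoef i\<close> lists the coefficients of \<open>D\<^sub>i\<close>.  Tuples of exponents are finitely supported
  functions on \<open>nat\<close>, so that appending zeros to a tuple is invisible.
\<close>

record ('k, 'f, 'w) hkg =
  emb :: "'k \<Rightarrow> 'f"
  base :: "'f set"
  pt :: "'f \<Rightarrow> int"
  smul :: "'f \<Rightarrow> 'w \<Rightarrow> 'w"
  dif :: "'f \<Rightarrow> 'w"
  len :: nat
  jump :: "nat \<Rightarrow> nat"
  ndeg :: "nat \<Rightarrow> nat"
  fld :: "nat \<Rightarrow> 'f set"
  gen :: "nat \<Rightarrow> 'f"
  acoef :: "nat \<Rightarrow> nat \<Rightarrow> 'k"
  dcoef :: "nat \<Rightarrow> (nat \<Rightarrow>\<^sub>0 nat) \<Rightarrow> 'k"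

definition G_order :: "('k, 'f::field, 'w) hkg \<Rightarrow> nat" where
  "G_order H = card (ram_group (base H) (pt H) 0)"

definition mbar :: "('k::field, 'f::field, 'w) hkg \<Rightarrow> nat \<Rightarrow> nat" where
  "mbar H i = CHAR('k) ^ (\<Sum>j\<in>{i+1..len H}. ndeg H j) * jump H i"

definition tuples :: "nat \<Rightarrow> (nat \<Rightarrow>\<^sub>0 nat) set" where
  "tuples m = {h. Poly_Mapping.keys h \<subseteq> {..<m}}"

definition tnorm :: "('k::field, 'f::field, 'w) hkg \<Rightarrow> (nat \<Rightarrow>\<^sub>0 nat) \<Rightarrow> nat" where
  "tnorm H h = Poly_Mapping.lookup h 0 * G_order H
     + (\<Sum>\<nu>\<in>{1..len H}. Poly_Mapping.lookup h \<nu> * mbar H \<nu>)"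

definition fmon :: "('k, 'f::field, 'w) hkg \<Rightarrow> (nat \<Rightarrow>\<^sub>0 nat) \<Rightarrow> 'f" where
  "fmon H h = (\<Prod>\<nu>\<le>len H. gen H \<nu> ^ Poly_Mapping.lookup h \<nu>)"

definition Lam :: "('k::field, 'f, 'w) hkg \<Rightarrow> nat \<Rightarrow> (nat \<Rightarrow>\<^sub>0 nat) set" where
  "Lam H i = {l \<in> tuples i. \<forall>\<nu>\<in>{1..<i}. Poly_Mapping.lookup l \<nu> < CHAR('k) ^ ndeg H \<nu>}"

definition Delem :: "('k::field, 'f::field, 'w) hkg \<Rightarrow> nat \<Rightarrow> 'f" where
  "Delem H i = (\<Sum>l | l \<in> Lam H i \<and> dcoef H i l \<noteq> 0. emb H (dcoef H i l) * fmon H l)"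

definition irr_poly :: "('k::field, 'f::field, 'w) hkg \<Rightarrow> nat \<Rightarrow> 'f poly" where
  "irr_poly H i =
     Polynomial.monom 1 (CHAR('k) ^ ndeg H i)
     + (\<Sum>j<ndeg H i. Polynomial.monom (emb H (acoef H i j)) (CHAR('k) ^ j))
     - [:Delem H i:]"

definition Aset :: "('k::field, 'f::field, 'w::ab_group_add) hkg \<Rightarrow> (nat \<Rightarrow>\<^sub>0 nat) set" where
  "Aset H = {h \<in> tuples (len H + 1).
     int (tnorm H h) \<le> 2 * int (genus (emb H) (smul H) (dif H)) - 2}"

definition AAset :: "('k::field, 'f::field, 'w::ab_group_add) hkg \<Rightarrow> (nat \<Rightarrow>\<^sub>0 nat) set" where
  "AAset H = {L + K | L K. L \<in> Aset H \<and> K \<in> Aset H}"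

definition omega :: "('k, 'f::field, 'w) hkg \<Rightarrow> (nat \<Rightarrow>\<^sub>0 nat) \<Rightarrow> 'w" where
  "omega H L = smul H (fmon H L) (dif H (gen H 0))"

text \<open>
  Besides the tower itself, \<open>hkg_tower\<close> records the known facts about HKG covers on which the notation
  rests: \<open>G\<^sub>0 = G\<^sub>1\<close>, the jumps are prime to the characteristic, the monomials of \<open>D\<^sub>i\<close> have bounded norm,
  and \<open>\<omega>\<^sub>L\<close> is a global section of \<open>\<Omega>\<^sub>X\<close> for \<open>L \<in> A\<close>.
\<close>

locale hkg_tower =
  fixes H :: "('k::alg_closed_field, 'f::field, 'w::ab_group_add) hkg"
  assumes cover: "hkg_cover (emb H) (base H) (pt H)"
    and kaehler: "kaehler_module (emb H) (smul H) (dif H)"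
    and G0_eq_G: "ram_group (base H) (pt H) 0 = gal_group (base H)"
    and G0_eq_G1: "ram_group (base H) (pt H) 0 = ram_group (base H) (pt H) 1"
    and jumps: "strict_mono_on {1..len H} (jump H)"
      "jump H ` {1..len H} =
        {j. ram_group (base H) (pt H) j \<noteq> ram_group (base H) (pt H) (j + 1)}"
    and jumps_coprime: "\<And>i. i \<in> {1..len H} \<Longrightarrow> coprime (jump H i) CHAR('k)"
    and fld_1: "fld H 1 = fixed_field (ram_group (base H) (pt H) 1)"
      "fld H 1 = adjoin (range (emb H)) (gen H 0)"
    and fld_Suc: "\<And>i. i \<in> {1..len H} \<Longrightarrow> fld H (i + 1) = adjoin (fld H i) (gen H i)"
    and fld_last: "fld H (len H + 1) = UNIV"
    and fld_degree:
      "\<And>i. i \<in> {1..len H} \<Longrightarrow> ext_degree (fld H i) (fld H (i + 1)) (CHAR('k) ^ ndeg H i)"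
    and G_order: "G_order H = CHAR('k) ^ (\<Sum>i\<in>{1..len H}. ndeg H i)"
    and pole_0: "pole_only_at (emb H) (pt H) (gen H 0) (G_order H)"
    and pole: "\<And>i. i \<in> {1..len H} \<Longrightarrow> pole_only_at (emb H) (pt H) (gen H i) (mbar H i)"
    and irr: "\<And>i. i \<in> {1..len H} \<Longrightarrow> irreducible_over (fld H i) (irr_poly H i)"
      "\<And>i. i \<in> {1..len H} \<Longrightarrow> poly (irr_poly H i) (gen H i) = 0"
    and D_finite: "\<And>i. i \<in> {1..len H} \<Longrightarrow> finite {l \<in> Lam H i. dcoef H i l \<noteq> 0}"
    and D_valuation: "\<And>i. i \<in> {1..len H} \<Longrightarrow>
        Delem H i \<in> fld H i \<and> Delem H i \<noteq> 0 \<and>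
        pt H (Delem H i) = - int (CHAR('k) ^ ndeg H i * mbar H i)"
    and D_norm: "\<And>i l. i \<in> {1..len H} \<Longrightarrow> l \<in> Lam H i \<Longrightarrow> dcoef H i l \<noteq> 0 \<Longrightarrow>
        tnorm H l \<le> CHAR('k) ^ ndeg H i * mbar H i"
    and omega_hol: "\<And>L. L \<in> Aset H \<Longrightarrow> omega H L \<in> hol_forms (emb H) (smul H) (dif H)"


section \<open>The elements of the symmetric algebra\<close>

abbreviation SymH0 :: "('k::field, 'f::field, 'w::ab_group_add) hkg \<Rightarrow> ('w fword \<Rightarrow>\<^sub>0 'k) set ring"
  where "SymH0 H \<equiv> sym_forms (emb H) (smul H) (dif H)"

definition sym_class ::
    "('k::field, 'f::field, 'w::ab_group_add) hkg \<Rightarrow> ('w fword \<Rightarrow>\<^sub>0 'k) \<Rightarrow> ('w fword \<Rightarrow>\<^sub>0 'k) set" where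
  "sym_class H u =
     (let V = hol_forms (emb H) (smul H) (dif H)
      in sym_ideal (ksmul (emb H) (smul H)) V +>\<^bsub>free_algebra V\<^esub> u)"

text \<open>\<open>ch u\<close> is the chosen pair \<open>(L, K)\<close> with \<open>L + K = u\<close>.\<close>

definition splits ::
    "('k::field, 'f::field, 'w::ab_group_add) hkg \<Rightarrow>
      ((nat \<Rightarrow>\<^sub>0 nat) \<Rightarrow> (nat \<Rightarrow>\<^sub>0 nat) \<times> (nat \<Rightarrow>\<^sub>0 nat)) \<Rightarrow> bool" where
  "splits H ch \<longleftrightarrow>
     (\<forall>u\<in>AAset H. fst (ch u) \<in> Aset H \<and> snd (ch u) \<in> Aset H \<and> fst (ch u) + snd (ch u) = u)"

definition omega2 ::
    "('k::field, 'f::field, 'w::ab_group_add) hkg \<Rightarrow>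
      ((nat \<Rightarrow>\<^sub>0 nat) \<Rightarrow> (nat \<Rightarrow>\<^sub>0 nat) \<times> (nat \<Rightarrow>\<^sub>0 nat)) \<Rightarrow> (nat \<Rightarrow>\<^sub>0 nat) \<Rightarrow>
      ('w fword \<Rightarrow>\<^sub>0 'k) set" where
  "omega2 H ch u =
     sym_class H (letter (omega H (fst (ch u)))) \<otimes>\<^bsub>SymH0 H\<^esub>
     sym_class H (letter (omega H (snd (ch u))))"

definition gam :: "('k::field, 'f, 'w) hkg \<Rightarrow> (nat \<Rightarrow>\<^sub>0 nat) \<Rightarrow> nat \<Rightarrow> nat \<Rightarrow> (nat \<Rightarrow>\<^sub>0 nat)" where
  "gam H v i \<nu> = v + Poly_Mapping.single i (CHAR('k) ^ (ndeg H i - \<nu>))"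

definition Gelem ::
    "('k::field, 'f::field, 'w::ab_group_add) hkg \<Rightarrow>
      ((nat \<Rightarrow>\<^sub>0 nat) \<Rightarrow> (nat \<Rightarrow>\<^sub>0 nat) \<times> (nat \<Rightarrow>\<^sub>0 nat)) \<Rightarrow> (nat \<Rightarrow>\<^sub>0 nat) \<Rightarrow> nat \<Rightarrow>
      ('w fword \<Rightarrow>\<^sub>0 'k) set" where
  "Gelem H ch v i =
     omega2 H ch (gam H v i 0)
     \<oplus>\<^bsub>SymH0 H\<^esub>
     (\<Oplus>\<^bsub>SymH0 H\<^esub> \<nu>\<in>{1..ndeg H i}.
        sym_class H (const (acoef H i (ndeg H i - \<nu>))) \<otimes>\<^bsub>SymH0 H\<^esub> omega2 H ch (gam H v i \<nu>))
     \<ominus>\<^bsub>SymH0 H\<^esub>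
     (\<Oplus>\<^bsub>SymH0 H\<^esub> l\<in>{l \<in> Lam H i. tnorm H l \<le> CHAR('k) ^ ndeg H i * mbar H i \<and> dcoef H i l \<noteq> 0}.
        sym_class H (const (dcoef H i l)) \<otimes>\<^bsub>SymH0 H\<^esub> omega2 H ch (l + v))"

end

theory Submission
  imports Defs
begin

text \<open>
  The forms \<open>\<omega>\<^sub>L\<close> are multiples of the single differential \<open>df\<^sub>0\<close>: a product \<open>\<omega>\<^sub>L \<omega>\<^sub>K\<close> is sent to
  \<open>f\<^sub>L f\<^sub>K df\<^sub>0 \<otimes> df\<^sub>0 = f\<^bsub>L+K\<^esub> df\<^sub>0 \<otimes> df\<^sub>0\<close>.  The monomials of the indices occurring in \<open>G\<^bsub>v,i\<^esub>\<close> are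
  \<open>f\<^sub>v\<close> times the monomials of the irreducible polynomial of \<open>f\<^sub>i\<close>, evaluated at \<open>f\<^sub>i\<close>.  So the image of
  \<open>G\<^bsub>v,i\<^esub>\<close> is \<open>f\<^sub>v\<close> times the value of that polynomial at its root \<open>f\<^sub>i\<close>, times \<open>df\<^sub>0 \<otimes> df\<^sub>0\<close>, hence \<open>0\<close>.

  What needs care is that the canonical map may be computed on any representative.  The
  commutators, which are zero in the symmetric algebra, go to commutators in the tensor algebra of
  \<open>\<Omega>\<close> over the function field, and these vanish because \<open>\<Omega>\<close> is spanned by one differential
  (\<open>differentials_one_dimensional\<close>, \<open>commutators_in_tensor_ideal\<close>, \<open>canonical_map_coset\<close>).  The
  spanning differential is \<open>dx\<close>, for a generator \<open>x\<close> of the rational base field \<open>E\<close>.  The quotient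
  rule gives \<open>dE \<subseteq> F dx\<close>.  An arbitrary function \<open>y\<close> is a simple root of \<open>\<Prod>(X - z)\<close>, where \<open>z\<close> runs
  over the Galois conjugates of \<open>y\<close>; this polynomial has coefficients in \<open>E\<close>, and differentiating the
  equation that it gives for \<open>y\<close> expresses \<open>dy\<close> through \<open>dE\<close>.
\<close>

section \<open>Derivations of a Galois extension\<close>

lemma ring_of_simps [simp]:
  "carrier (ring_of TYPE('a::ring_1)) = UNIV"
  "monoid.mult (ring_of TYPE('a)) = (*)"
  "monoid.one (ring_of TYPE('a)) = 1"
  "ring.zero (ring_of TYPE('a)) = 0"
  "ring.add (ring_of TYPE('a)) = (+)"
  by (auto simp: ring_of_type_algebra_def fun_eq_iff)

lemma a_inv_ring_of [simp]: "\<ominus>\<^bsub>ring_of TYPE('a::comm_ring_1)\<^esub> (x::'a) = - x"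
proof -
  interpret ring "ring_of TYPE('a)" by (rule ring_from_type_algebra)
  show ?thesis using minus_equality[of "- x" x] by simp
qed

lemma m_inv_ring_of [simp]:
  assumes "x \<noteq> 0"
  shows "inv\<^bsub>ring_of TYPE('a::field)\<^esub> (x::'a) = inverse x"
proof -
  interpret field "ring_of TYPE('a)" by (rule field_from_type_algebra)
  show ?thesis using inv_unique'[of x "inverse x"] assms by simp
qed

locale field_derivation = vector_space smul
  for smul :: "'f::field \<Rightarrow> 'w::ab_group_add \<Rightarrow> 'w" +
  fixes d :: "'f \<Rightarrow> 'w"
  assumes d_add: "d (x + y) = d x + d y"
    and d_mult: "d (x * y) = smul x (d y) + smul y (d x)"
begin

lemma d_0 [simp]: "d 0 = 0"
  using d_add[of 0 0] by simp

lemma d_1 [simp]: "d 1 = 0"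
  using d_mult[of 1 1] by simp

lemma d_uminus: "d (- x) = - d x"
  using d_add[of x "- x"] by (simp add: eq_neg_iff_add_eq_0 add.commute)

lemma d_inverse:
  assumes "x \<noteq> 0"
  shows "d (inverse x) = smul (- (inverse x * inverse x)) (d x)"
proof -
  have "0 = smul (inverse x) (d (x * inverse x))"
    using assms by simp
  also have "\<dots> = d (inverse x) + smul (inverse x * inverse x) (d x)"
    using assms by (simp add: d_mult scale_right_distrib del: right_inverse)
  finally show ?thesis
    by (simp add: eq_neg_iff_add_eq_0)
qed

text \<open>
  The functions whose differential lies in a fixed subspace form a field, by the Leibniz and the
  quotient rule.
\<close>

lemma d_generate_field_in_subspace:
  assumes S: "subspace S" and H: "\<And>h. h \<in> H \<Longrightarrow> d h \<in> S"
    and x: "x \<in> generate_field (ring_of TYPE('f)) H"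
  shows "d x \<in> S"
  using x
proof (induction rule: generate_field.induct)
  case one
  then show ?case using subspace_0[OF S] by simp
next
  case (a_inv h)
  then show ?case using subspace_neg[OF S] by (simp add: d_uminus)
next
  case (m_inv h)
  then show ?case using subspace_scale[OF S, of "d h"] by (simp add: d_inverse del: scale_minus_left)
next
  case (eng_mult h1 h2)
  then show ?case by (simp add: d_mult S subspace_add subspace_scale)
qed (use H in \<open>simp_all add: d_add S subspace_add\<close>)

text \<open>
  The chain rule, where the contribution of the coefficients is known only up to a subspace.
\<close>

lemma d_poly:
  assumes S: "subspace S" and "\<And>j. d (poly.coeff g j) \<in> S"
  shows "d (poly g y) - smul (poly (pderiv g) y) (d y) \<in> S"
  using assms(2)
proof (induction g)
  case 0
  then show ?case using subspace_0[OF S] by simp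
next
  case (pCons a p)
  have a: "d a \<in> S" using pCons.prems[of 0] by simp
  have "d (poly p y) - smul (poly (pderiv p) y) (d y) \<in> S"
    using pCons.IH pCons.prems[of "Suc _"] by simp
  then have "d a + smul y (d (poly p y) - smul (poly (pderiv p) y) (d y)) \<in> S"
    using a by (simp add: S subspace_add subspace_scale)
  moreover have "d a + smul y (d (poly p y) - smul (poly (pderiv p) y) (d y))
      = d (poly (pCons a p) y) - smul (poly (pderiv (pCons a p)) y) (d y)"
    by (simp add: d_add d_mult pderiv_pCons scale_right_diff_distrib scale_left_distrib)
  ultimately show ?case by simp
qed

end

lemma map_poly_times:
  fixes s :: "'a::comm_semiring_0 \<Rightarrow> 'b::comm_semiring_0"
  assumes 0: "s 0 = 0" and add: "\<And>x y. s (x + y) = s x + s y" and mult: "\<And>x y. s (x * y) = s x * s y"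
  shows "map_poly s (p * q) = map_poly s p * map_poly s q"
proof (rule poly_eqI)
  fix n
  have "s (sum f A) = (\<Sum>i\<in>A. s (f i))" for f and A :: "nat set"
    by (induction A rule: infinite_finite_induct) (auto simp: 0 add)
  then show "poly.coeff (map_poly s (p * q)) n = poly.coeff (map_poly s p * map_poly s q) n"
    by (simp add: coeff_map_poly 0 coeff_mult mult)
qed

lemma gal_group_hom:
  assumes "\<sigma> \<in> gal_group (E :: 'f::field set)"
  shows "\<sigma> (x + y) = \<sigma> x + \<sigma> y" "\<sigma> (x * y) = \<sigma> x * \<sigma> y" "\<sigma> 1 = 1" "\<sigma> 0 = 0"
    "\<sigma> (- x) = - \<sigma> x" "inj \<sigma>"
proof -
  have *: "\<sigma> \<in> ring_iso (ring_of TYPE('f)) (ring_of TYPE('f))"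
    using assms by (simp add: gal_group_def)
  have hom: "\<sigma> \<in> ring_hom (ring_of TYPE('f)) (ring_of TYPE('f))"
    using * by (simp add: ring_iso_def)
  show "inj \<sigma>" using * by (simp add: ring_iso_def bij_betw_def)
  show add: "\<sigma> (x + y) = \<sigma> x + \<sigma> y" for x y using ring_hom_add[OF hom] by simp
  show "\<sigma> (x * y) = \<sigma> x * \<sigma> y" using ring_hom_mult[OF hom] by simp
  show "\<sigma> 1 = 1" using ring_hom_one[OF hom] by simp
  show z: "\<sigma> 0 = 0" using add[of 0 0] by (metis add.right_neutral add_left_cancel)
  show "\<sigma> (- x) = - \<sigma> x" using add[of x "- x"] z
    by (simp add: eq_neg_iff_add_eq_0 add.commute)
qed

lemma gal_group_comp:
  assumes "\<sigma> \<in> gal_group (E :: 'f::field set)" "\<tau> \<in> gal_group E"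
  shows "\<tau> \<circ> \<sigma> \<in> gal_group E"
  using assms unfolding gal_group_def ring_iso_def
  by (auto intro: ring_hom_trans bij_betw_trans)

lemma id_gal_group: "id \<in> gal_group (E :: 'f::field set)"
  by (auto simp: gal_group_def ring_iso_def ring_hom_def)

text \<open>
  The product of \<open>X - z\<close> over the distinct conjugates \<open>z\<close> of \<open>y\<close>.  Its coefficients are invariant
  because the Galois group permutes the conjugates, and \<open>y\<close> is a simple root because each conjugate
  is taken only once.
\<close>

lemma orbit_polynomial:
  fixes E :: "'f::field set"
  assumes fin: "finite (gal_group E)" and gal: "fixed_field (gal_group E) = E"
  obtains g where "\<And>j. poly.coeff g j \<in> E" "poly g y = 0" "poly (pderiv g) y \<noteq> 0"
proof
  define Orb where "Orb = (\<lambda>\<sigma>. \<sigma> y) ` gal_group E"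
  define g where "g = (\<Prod>z\<in>Orb. [:- z, 1:])"
  have finO: "finite Orb" using fin by (simp add: Orb_def)
  have y: "y \<in> Orb" unfolding Orb_def by (rule image_eqI[OF _ id_gal_group]) simp
  show "poly g y = 0" using finO y by (auto simp: g_def poly_prod)
  have "g = [:- y, 1:] * (\<Prod>z\<in>Orb - {y}. [:- z, 1:])"
    unfolding g_def by (rule prod.remove[OF finO y])
  then have "poly (pderiv g) y = poly (\<Prod>z\<in>Orb - {y}. [:- z, 1:]) y"
    by (simp add: pderiv_mult pderiv_pCons del: mult_pCons_left)
  then show "poly (pderiv g) y \<noteq> 0"
    using finO by (auto simp: poly_prod)
  show "poly.coeff g j \<in> E" for j
  proof -
    have "\<tau> (poly.coeff g j) = poly.coeff g j" if \<tau>: "\<tau> \<in> gal_group E" for \<tau>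
    proof -
      note h = gal_group_hom[OF \<tau>]
      have sub: "\<tau> ` Orb \<subseteq> Orb"
      proof
        fix z assume "z \<in> \<tau> ` Orb"
        then obtain \<sigma> where "\<sigma> \<in> gal_group E" "z = (\<tau> \<circ> \<sigma>) y" by (auto simp: Orb_def)
        then show "z \<in> Orb" using gal_group_comp[OF _ \<tau>] unfolding Orb_def by blast
      qed
      have inj: "inj_on \<tau> Orb" using h(6) by (rule inj_on_subset) simp
      have img: "\<tau> ` Orb = Orb" using finO sub inj by (simp add: endo_inj_surj)
      have "map_poly \<tau> (\<Prod>z\<in>A. [:- z, 1:]) = (\<Prod>z\<in>A. [:- \<tau> z, 1:])" for A
        by (induction A rule: infinite_finite_induct)
          (simp_all add: map_poly_times h map_poly_pCons del: mult_pCons_left)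
      then have "map_poly \<tau> g = (\<Prod>z\<in>\<tau> ` Orb. [:- z, 1:])"
        by (simp add: g_def prod.reindex[OF inj])
      then have "map_poly \<tau> g = g" by (simp add: img g_def)
      then show ?thesis by (metis coeff_map_poly h(4))
    qed
    then show ?thesis using gal by (auto simp: fixed_field_def)
  qed
qed

text \<open>
  A derivation of a finite Galois extension is determined by its values on the base: differentiate
  an equation of which \<open>y\<close> is a simple root and divide by the derivative at \<open>y\<close>.
\<close>

lemma (in field_derivation) d_in_subspace_of_galois:
  assumes "finite (gal_group E)" "fixed_field (gal_group E) = E"
    and S: "subspace S" and E: "\<And>x. x \<in> E \<Longrightarrow> d x \<in> S"
  shows "d y \<in> S"
proof -
  obtain g where g: "\<And>j. poly.coeff g j \<in> E" "poly g y = 0" "poly (pderiv g) y \<noteq> 0"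
    using orbit_polynomial[OF assms(1,2)] by metis
  have "- smul (poly (pderiv g) y) (d y) \<in> S"
    using d_poly[OF S, of g y] E g by simp
  then have "smul (inverse (poly (pderiv g) y)) (- (- smul (poly (pderiv g) y) (d y))) \<in> S"
    using S by (simp only: subspace_neg subspace_scale)
  then show ?thesis using g(3) by simp
qed

section \<open>The line of Kaehler differentials\<close>

lemma form_of_superset:
  fixes smul :: "'f::field \<Rightarrow> 'w::ab_group_add \<Rightarrow> 'w"
  assumes "vector_space smul" "finite A" "Poly_Mapping.keys u \<subseteq> A"
  shows "form_of smul d u = (\<Sum>x\<in>A. smul (Poly_Mapping.lookup u x) (d x))"
proof -
  interpret vector_space smul by fact
  show ?thesis unfolding form_of_def
    by (rule sum.mono_neutral_left) (use assms in \<open>auto simp: in_keys_iff\<close>)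
qed

lemma form_of_linear:
  fixes smul :: "'f::field \<Rightarrow> 'w::ab_group_add \<Rightarrow> 'w"
  assumes "vector_space smul"
  shows "form_of smul d (u + v) = form_of smul d u + form_of smul d v"
    and "form_of smul d (u - v) = form_of smul d u - form_of smul d v"
    and "form_of smul d (Poly_Mapping.single x a) = smul a (d x)"
    and "form_of smul d (Poly_Mapping.map ((*) c) u) = smul c (form_of smul d u)"
proof -
  interpret vector_space smul by fact
  let ?A = "Poly_Mapping.keys u \<union> Poly_Mapping.keys v"
  note s = form_of_superset[OF assms, of ?A]
  show "form_of smul d (u + v) = form_of smul d u + form_of smul d v"
    using Poly_Mapping.keys_add[of u v]
    by (simp add: s lookup_add scale_left_distrib sum.distrib)
  show "form_of smul d (u - v) = form_of smul d u - form_of smul d v"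
    using keys_diff[of u v]
    by (simp add: s lookup_minus scale_left_diff_distrib sum_subtractf)
  show "form_of smul d (Poly_Mapping.single x a) = smul a (d x)"
    by (simp add: form_of_def)
  have "Poly_Mapping.keys (Poly_Mapping.map ((*) c) u) \<subseteq> Poly_Mapping.keys u"
    by (auto simp: in_keys_iff Poly_Mapping.map.rep_eq when_def)
  then show "form_of smul d (Poly_Mapping.map ((*) c) u) = smul c (form_of smul d u)"
    by (subst form_of_superset[OF assms, of "Poly_Mapping.keys u"])
      (auto simp: form_of_def Poly_Mapping.map.rep_eq scale_sum_right when_def in_keys_iff intro!: sum.cong)
qed

lemma module_poly_mapping:
  "Modules.module (\<lambda>c. Poly_Mapping.map ((*) (c :: 'f::comm_ring_1)) :: ('x \<Rightarrow>\<^sub>0 'f) \<Rightarrow> 'x \<Rightarrow>\<^sub>0 'f)"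
proof -
  have "Poly_Mapping.lookup (Poly_Mapping.map ((*) c) u) k = c * Poly_Mapping.lookup u k"
    for c :: 'f and u :: "'x \<Rightarrow>\<^sub>0 'f" and k
    by (simp add: Poly_Mapping.map.rep_eq when_def)
  then show ?thesis
    by unfold_locales (auto intro!: poly_mapping_eqI simp: lookup_add algebra_simps)
qed

text \<open>
  A relation lies in its own span, hence is killed by \<open>form_of\<close>; the three families of relations
  are additivity, the Leibniz rule and triviality on constants.
\<close>

lemma kaehler_derivation:
  fixes emb :: "'k::field \<Rightarrow> 'f::field" and smul :: "'f \<Rightarrow> 'w::ab_group_add \<Rightarrow> 'w" and d :: "'f \<Rightarrow> 'w"
  assumes "kaehler_module emb smul d"
  shows "field_derivation smul d" and "d (emb c) = 0"
proof -
  interpret vector_space smul using assms by (simp add: kaehler_module_def)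
  have rel: "form_of smul d u = 0" if "u \<in> kaehler_relations emb" for u
    using assms module.span_base[OF module_poly_mapping that]
    unfolding kaehler_module_def by blast
  note lin = form_of_linear[OF vector_space_axioms]
  have "form_of smul d (Poly_Mapping.single (emb c) 1) = 0"
    by (rule rel) (auto simp: kaehler_relations_def)
  then show "d (emb c) = 0" by (simp add: lin)
  show "field_derivation smul d"
  proof
    fix x y
    have "form_of smul d
        (Poly_Mapping.single (x + y) 1 - Poly_Mapping.single x 1 - Poly_Mapping.single y 1) = 0"
      by (rule rel) (auto simp: kaehler_relations_def)
    then show "d (x + y) = d x + d y" by (simp add: lin algebra_simps)
    have "form_of smul d
        (Poly_Mapping.single (x * y) 1 - Poly_Mapping.single y x - Poly_Mapping.single x y) = 0"
      by (rule rel) (auto simp: kaehler_relations_def)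
    then show "d (x * y) = smul x (d y) + smul y (d x)" by (simp add: lin algebra_simps)
  qed
qed

text \<open>
  The line is spanned by the differential of a generator of the rational base field.
\<close>

lemma differentials_one_dimensional:
  fixes emb :: "'k::alg_closed_field \<Rightarrow> 'f::field" and smul :: "'f \<Rightarrow> 'w::ab_group_add \<Rightarrow> 'w" and d :: "'f \<Rightarrow> 'w"
  assumes "hkg_cover emb E P" and kae: "kaehler_module emb smul d"
  obtains e where "\<And>w. \<exists>a. w = smul a e"
proof -
  interpret hkg_cover emb E P by fact
  interpret field_derivation smul d using kaehler_derivation(1)[OF kae] .
  obtain x where x: "E = adjoin (range emb) x" using base_rational by blast
  have S: "subspace (span {d x})" by (rule subspace_span)
  have "d z \<in> span {d x}" if "z \<in> E" for z
    using that unfolding x adjoin_def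
    by (rule d_generate_field_in_subspace[OF S, rotated])
      (auto simp: kaehler_derivation(2)[OF kae] span_base span_zero)
  \<comment> \<open>an infinite group would have \<open>card\<close> zero, which is no power of a positive number\<close>
  moreover have "finite (gal_group E)"
    using p_group char_pos by (metis card.infinite power_eq_0_iff less_numeral_extra(3))
  ultimately have *: "d y \<in> span {d x}" for y
    using d_in_subspace_of_galois[OF _ galois S] by blast
  have "w \<in> span {d x}" for w
  proof -
    have "w \<in> range (form_of smul d)" using kae by (simp add: kaehler_module_def)
    then show ?thesis by (auto simp: form_of_def intro!: span_sum span_scale *)
  qed
  then show thesis using that[of "d x"] by (auto simp: span_singleton)
qed

section \<open>The free algebra on a set of letters\<close>

lemma free_algebra_simps [simp]:
  "carrier (free_algebra V) = {u. \<forall>w\<in>Poly_Mapping.keys u. set (letters w) \<subseteq> V}"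
  "monoid.mult (free_algebra V) = (*)"
  "monoid.one (free_algebra V) = 1"
  "ring.zero (free_algebra V) = 0"
  "ring.add (free_algebra V) = (+)"
  by (simp_all add: free_algebra_def)

lemma free_algebra_closed:
  fixes u v :: "'w fword \<Rightarrow>\<^sub>0 'r::comm_ring_1"
  shows "(0 :: 'w fword \<Rightarrow>\<^sub>0 'r) \<in> carrier (free_algebra V)"
    "(1 :: 'w fword \<Rightarrow>\<^sub>0 'r) \<in> carrier (free_algebra V)"
    "(const c :: 'w fword \<Rightarrow>\<^sub>0 'r) \<in> carrier (free_algebra V)"
    "x \<in> V \<Longrightarrow> (letter x :: 'w fword \<Rightarrow>\<^sub>0 'r) \<in> carrier (free_algebra V)"
    "u \<in> carrier (free_algebra V) \<Longrightarrow> - u \<in> carrier (free_algebra V)"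
    "u \<in> carrier (free_algebra V) \<Longrightarrow> v \<in> carrier (free_algebra V) \<Longrightarrow>
      u + v \<in> carrier (free_algebra V)"
    "u \<in> carrier (free_algebra V) \<Longrightarrow> v \<in> carrier (free_algebra V) \<Longrightarrow>
      u - v \<in> carrier (free_algebra V)"
    "u \<in> carrier (free_algebra V) \<Longrightarrow> v \<in> carrier (free_algebra V) \<Longrightarrow>
      u * v \<in> carrier (free_algebra V)"
proof -
  show add: "u \<in> carrier (free_algebra V) \<Longrightarrow> v \<in> carrier (free_algebra V) \<Longrightarrow>
      u + v \<in> carrier (free_algebra V)"
    for u v :: "'w fword \<Rightarrow>\<^sub>0 'r"
    using Poly_Mapping.keys_add[of u v] by auto
  show minus: "u \<in> carrier (free_algebra V) \<Longrightarrow> - u \<in> carrier (free_algebra V)" for u :: "'w fword \<Rightarrow>\<^sub>0 'r"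
    by (auto simp: in_keys_iff)
  show "u \<in> carrier (free_algebra V) \<Longrightarrow> v \<in> carrier (free_algebra V) \<Longrightarrow>
      u - v \<in> carrier (free_algebra V)"
    using add[of u "- v"] minus[of v] by simp
  show "u \<in> carrier (free_algebra V) \<Longrightarrow> v \<in> carrier (free_algebra V) \<Longrightarrow>
      u * v \<in> carrier (free_algebra V)"
    using keys_mult[of u v] by (fastforce simp: plus_fword_def)
qed (auto simp: zero_fword_def)

lemma ring_free_algebra: "ring (free_algebra V :: ('w fword \<Rightarrow>\<^sub>0 'r::comm_ring_1) ring)"
proof (rule ringI)
  show "abelian_group (free_algebra V :: ('w fword \<Rightarrow>\<^sub>0 'r) ring)"
  proof (rule abelian_groupI)
    fix u :: "'w fword \<Rightarrow>\<^sub>0 'r" assume "u \<in> carrier (free_algebra V)"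
    then have "- u \<in> carrier (free_algebra V)" by (rule free_algebra_closed)
    then show "\<exists>v\<in>carrier (free_algebra V). v \<oplus>\<^bsub>free_algebra V\<^esub> u = \<zero>\<^bsub>free_algebra V\<^esub>"
      by (rule bexI[rotated]) simp
  qed (use free_algebra_closed(1,6)[where V = V] in \<open>simp_all add: add_ac\<close>)
  show "monoid (free_algebra V :: ('w fword \<Rightarrow>\<^sub>0 'r) ring)"
    by (rule monoidI) (use free_algebra_closed(2,8)[where V = V] in \<open>simp_all add: mult.assoc\<close>)
qed (simp_all add: algebra_simps)

lemma a_inv_free_algebra [simp]:
  assumes "u \<in> carrier (free_algebra V)"
  shows "\<ominus>\<^bsub>free_algebra V\<^esub> u = - u"
proof -
  interpret ring "free_algebra V" by (rule ring_free_algebra)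
  show ?thesis using minus_equality[of "- u" u] assms free_algebra_closed(5)[OF assms] by simp
qed

lemma sum_in_free_algebra:
  fixes f :: "'b \<Rightarrow> 'w fword \<Rightarrow>\<^sub>0 'r::comm_ring_1"
  assumes "\<And>x. x \<in> A \<Longrightarrow> f x \<in> carrier (free_algebra V)"
  shows "sum f A \<in> carrier (free_algebra V)"
  using assms
proof (induction A rule: infinite_finite_induct)
  case (insert x A)
  then have "f x + sum f A \<in> carrier (free_algebra V)"
    by (intro free_algebra_closed(6)) blast+
  then show ?case by (simp only: sum.insert[OF insert.hyps])
qed simp_all

lemma linear_relations_closed:
  fixes smul :: "'r::comm_ring_1 \<Rightarrow> 'w::ab_group_add \<Rightarrow> 'w"
  assumes "\<And>x y. x \<in> V \<Longrightarrow> y \<in> V \<Longrightarrow> x + y \<in> V" and "\<And>c x. x \<in> V \<Longrightarrow> smul c x \<in> V"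
  shows "linear_relations smul V \<subseteq> carrier (free_algebra V)"
  unfolding linear_relations_def
  by (intro Un_least subsetI; elim CollectE exE conjE; hypsubst; intro free_algebra_closed assms)

lemma commutators_closed: "commutators V \<subseteq> carrier (free_algebra V)"
  unfolding commutators_def
  by (intro subsetI; elim CollectE exE conjE; hypsubst; intro free_algebra_closed)

section \<open>Congruences in the tensor algebra\<close>

lemma tensor_ideal_rules:
  fixes smul :: "'r::comm_ring_1 \<Rightarrow> 'w::ab_group_add \<Rightarrow> 'w"
  defines "J \<equiv> tensor_ideal smul UNIV"
  shows "ideal J (free_algebra UNIV)" "linear_relations smul UNIV \<subseteq> J"
    "0 \<in> J" "u \<in> J \<Longrightarrow> v \<in> J \<Longrightarrow> u + v \<in> J" "u \<in> J \<Longrightarrow> v \<in> J \<Longrightarrow> u - v \<in> J" "u \<in> J \<Longrightarrow> - u \<in> J"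
    "u \<in> J \<Longrightarrow> t * u \<in> J" "u \<in> J \<Longrightarrow> u * t \<in> J"
proof -
  interpret R: ring "free_algebra UNIV :: ('w fword \<Rightarrow>\<^sub>0 'r) ring" by (rule ring_free_algebra)
  show J: "ideal J (free_algebra UNIV)" unfolding J_def tensor_ideal_def
    by (rule R.genideal_ideal) simp
  show "linear_relations smul UNIV \<subseteq> J" unfolding J_def tensor_ideal_def
    by (rule R.genideal_self) simp
  interpret J: ideal J "free_algebra UNIV" by (rule J)
  show "0 \<in> J" using J.zero_closed by simp
  show add: "u \<in> J \<Longrightarrow> v \<in> J \<Longrightarrow> u + v \<in> J" for u v using J.a_closed by simp
  show neg: "u \<in> J \<Longrightarrow> - u \<in> J" for u using J.a_inv_closed[of u] by simp
  show "u \<in> J \<Longrightarrow> v \<in> J \<Longrightarrow> u - v \<in> J" using add[of u "- v"] neg[of v] by simp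
  show "u \<in> J \<Longrightarrow> t * u \<in> J" using J.I_l_closed[of u t] by simp
  show "u \<in> J \<Longrightarrow> u * t \<in> J" using J.I_r_closed[of u t] by simp
qed

text \<open>
  Reduces identities that are additive in \<open>u\<close> to monomials.
\<close>

lemma sum_single_lookup:
  "u = (\<Sum>k\<in>Poly_Mapping.keys u. Poly_Mapping.single k (Poly_Mapping.lookup u k))"
  by (rule poly_mapping_eqI) (simp add: lookup_sum lookup_single when_def in_keys_iff)

lemma const_central: "const c * u = u * const (c :: 'r::comm_ring_1)"
proof -
  obtain A g where u: "u = (\<Sum>k\<in>A. Poly_Mapping.single k (g k))"
    by (rule that[OF sum_single_lookup])
  show ?thesis by (simp add: u sum_distrib_left sum_distrib_right mult_single mult.commute)
qed

lemma letter_smul_cong: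
  fixes smul :: "'r::comm_ring_1 \<Rightarrow> 'w::ab_group_add \<Rightarrow> 'w"
  shows "letter (smul c x) - const c * letter x \<in> tensor_ideal smul UNIV"
  using tensor_ideal_rules(2)[where smul = smul] unfolding linear_relations_def by blast

text \<open>
  The tensor square of a line is spanned by \<open>e \<otimes> e\<close>.
\<close>

lemma letter_smul_times_cong:
  fixes smul :: "'r::comm_ring_1 \<Rightarrow> 'w::ab_group_add \<Rightarrow> 'w"
  shows "letter (smul a e) * letter (smul b e) - const (a * b) * (letter e * letter e)
    \<in> tensor_ideal smul UNIV"
proof -
  note r = tensor_ideal_rules[where smul = smul]
  have "(letter (smul a e) - const a * letter e) * letter (smul b e)
      + const a * letter e * (letter (smul b e) - const b * letter e) \<in> tensor_ideal smul UNIV"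
    by (intro r(4,7,8) letter_smul_cong)
  moreover have "(const a * letter e) * (const b * letter e) = const (a * b) * (letter e * letter e)"
  proof -
    have "(const a * letter e) * (const b * letter e) = const a * (const b * letter e) * letter e"
      by (simp only: mult.assoc const_central[of b "letter e"])
    then show ?thesis by (simp add: mult.assoc[symmetric] mult_single)
  qed
  ultimately show ?thesis by (simp add: algebra_simps)
qed

text \<open>
  On a line, \<open>ae \<otimes> be\<close> and \<open>be \<otimes> ae\<close> are both \<open>ab (e \<otimes> e)\<close>.
\<close>

lemma commutators_in_tensor_ideal:
  fixes smul :: "'r::comm_ring_1 \<Rightarrow> 'w::ab_group_add \<Rightarrow> 'w"
  assumes "\<And>w. \<exists>a. w = smul a e"
  shows "commutators UNIV \<subseteq> tensor_ideal smul UNIV"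
proof -
  have "letter x * letter y - letter y * letter x \<in> tensor_ideal smul UNIV" for x y
  proof -
    obtain a b where "x = smul a e" "y = smul b e" using assms by metis
    then show ?thesis
      using tensor_ideal_rules(5)[OF letter_smul_times_cong[of smul a e b]
          letter_smul_times_cong[of smul b e a]]
      by (simp add: mult.commute[of a b])
  qed
  then show ?thesis by (auto simp: commutators_def)
qed

section \<open>The canonical map on representatives\<close>

lemma ring_hom_ring_of:
  fixes f :: "'k::comm_ring_1 \<Rightarrow> 'f::comm_ring_1"
  assumes "f \<in> ring_hom (ring_of TYPE('k)) (ring_of TYPE('f))"
  shows "f 0 = 0" "f 1 = 1" "f (x + y) = f x + f y" "f (x * y) = f x * f y" "f (- x) = - f x"
proof -
  show add: "f (x + y) = f x + f y" for x y using ring_hom_add[OF assms] by simp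
  show "f (x * y) = f x * f y" using ring_hom_mult[OF assms] by simp
  show "f 1 = 1" using ring_hom_one[OF assms] by simp
  show z: "f 0 = 0" using add[of 0 0] by (metis add.right_neutral add_left_cancel)
  show "f (- x) = - f x" using add[of x "- x"] z
    by (simp add: eq_neg_iff_add_eq_0 add.commute)
qed

lemma map_poly_mapping_additive:
  fixes f :: "'k::comm_ring_1 \<Rightarrow> 'f::comm_ring_1"
  assumes "f \<in> ring_hom (ring_of TYPE('k)) (ring_of TYPE('f))"
  shows "Poly_Mapping.map f (u + v) = Poly_Mapping.map f u + Poly_Mapping.map f v"
    and "Poly_Mapping.map f 0 = 0"
    and "Poly_Mapping.map f (- u) = - Poly_Mapping.map f u"
    and "Poly_Mapping.map f (u - v) = Poly_Mapping.map f u - Poly_Mapping.map f v"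
    and "Poly_Mapping.map f (Poly_Mapping.single k c) = Poly_Mapping.single k (f c)"
proof -
  note f = ring_hom_ring_of[OF assms]
  have lk: "Poly_Mapping.lookup (Poly_Mapping.map f u) k = f (Poly_Mapping.lookup u k)"
    for u :: "'x \<Rightarrow>\<^sub>0 'k" and k
    by (simp add: Poly_Mapping.map.rep_eq when_def f)
  show add: "Poly_Mapping.map f (u + v) = Poly_Mapping.map f u + Poly_Mapping.map f v" for u v
    by (rule poly_mapping_eqI) (simp add: lk lookup_add f)
  show minus: "Poly_Mapping.map f (- u) = - Poly_Mapping.map f u" for u
    by (rule poly_mapping_eqI) (simp add: lk f)
  show "Poly_Mapping.map f (u - v) = Poly_Mapping.map f u - Poly_Mapping.map f v"
    using add[of u "- v"] minus[of v] by simp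
qed (simp_all add: map_eq_zero_iff ring_hom_ring_of[OF assms])

lemma map_poly_mapping_sum:
  fixes f :: "'k::comm_ring_1 \<Rightarrow> 'f::comm_ring_1"
  assumes "f \<in> ring_hom (ring_of TYPE('k)) (ring_of TYPE('f))"
  shows "Poly_Mapping.map f (sum h A) = (\<Sum>x\<in>A. Poly_Mapping.map f (h x))"
  by (induction A rule: infinite_finite_induct) (auto simp: map_poly_mapping_additive[OF assms])

lemma map_poly_mapping_mult:
  fixes f :: "'k::comm_ring_1 \<Rightarrow> 'f::comm_ring_1" and p q :: "'m::monoid_add \<Rightarrow>\<^sub>0 'k"
  assumes "f \<in> ring_hom (ring_of TYPE('k)) (ring_of TYPE('f))"
  shows "Poly_Mapping.map f (p * q) = Poly_Mapping.map f p * Poly_Mapping.map f q"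
proof -
  obtain A g B h where p: "p = (\<Sum>k\<in>A. Poly_Mapping.single k (g k))"
    and q: "q = (\<Sum>k\<in>B. Poly_Mapping.single k (h k))"
    by (rule that[OF sum_single_lookup sum_single_lookup])
  show ?thesis
    by (simp add: p q sum_product mult_single map_poly_mapping_sum[OF assms]
        map_poly_mapping_additive[OF assms] ring_hom_ring_of[OF assms])
qed

lemmas map_poly_mapping_hom =
  map_poly_mapping_additive map_poly_mapping_sum map_poly_mapping_mult

lemma ideal_sym_ideal:
  fixes smul :: "'r::comm_ring_1 \<Rightarrow> 'w::ab_group_add \<Rightarrow> 'w"
  assumes "\<And>x y. x \<in> V \<Longrightarrow> y \<in> V \<Longrightarrow> x + y \<in> V" and "\<And>c x. x \<in> V \<Longrightarrow> smul c x \<in> V"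
  shows "ideal (sym_ideal smul V) (free_algebra V)"
  unfolding sym_ideal_def
  by (intro ring.genideal_ideal ring_free_algebra Un_least linear_relations_closed
      commutators_closed assms)

text \<open>
  Extending scalars maps the relations of the symmetric algebra to relations of the tensor algebra
  and to commutators.  The preimage of the tensor ideal is an ideal, so it contains everything that
  the relations generate.
\<close>

lemma map_sym_ideal:
  fixes emb :: "'k::field \<Rightarrow> 'f::field" and smul :: "'f \<Rightarrow> 'w::ab_group_add \<Rightarrow> 'w"
  assumes hom: "emb \<in> ring_hom (ring_of TYPE('k)) (ring_of TYPE('f))"
    and V: "\<And>x y. x \<in> V \<Longrightarrow> y \<in> V \<Longrightarrow> x + y \<in> V" "\<And>c x. x \<in> V \<Longrightarrow> smul (emb c) x \<in> V"
    and line: "\<And>w. \<exists>a. w = smul a e"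
    and u: "u \<in> sym_ideal (ksmul emb smul) V"
  shows "Poly_Mapping.map emb u \<in> tensor_ideal smul UNIV"
proof -
  let ?R = "free_algebra V :: ('w fword \<Rightarrow>\<^sub>0 'k) ring"
  let ?m = "Poly_Mapping.map emb"
  define K where "K = {u \<in> carrier ?R. ?m u \<in> tensor_ideal smul UNIV}"
  note r = tensor_ideal_rules[where smul = smul]
  note h = map_poly_mapping_hom[OF hom] ring_hom_ring_of[OF hom]
  have "ideal K ?R"
  proof (rule idealI)
    show "ring ?R" by (rule ring_free_algebra)
    interpret R: ring ?R by (rule ring_free_algebra)
    show "subgroup K (add_monoid ?R)"
    proof (rule R.add.subgroupI)
      show "K \<subseteq> carrier ?R" by (auto simp: K_def)
      have "0 \<in> K" using free_algebra_closed(1)[of V] r(3) by (simp add: K_def h)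
      then show "K \<noteq> {}" by blast
      show "\<ominus>\<^bsub>?R\<^esub> a \<in> K" if "a \<in> K" for a
        using that free_algebra_closed(5)[of a V] r(6) unfolding K_def by (simp add: h)
      show "a \<oplus>\<^bsub>?R\<^esub> b \<in> K" if "a \<in> K" "b \<in> K" for a b
        using that free_algebra_closed(6)[of a V b] r(4) unfolding K_def by (simp add: h)
    qed
    show "x \<otimes>\<^bsub>?R\<^esub> a \<in> K" if "a \<in> K" "x \<in> carrier ?R" for a x
      using that free_algebra_closed(8)[of x V a] r(7) unfolding K_def by (simp add: h)
    show "a \<otimes>\<^bsub>?R\<^esub> x \<in> K" if "a \<in> K" "x \<in> carrier ?R" for a x
      using that free_algebra_closed(8)[of a V x] r(8) unfolding K_def by (simp add: h)
  qed
  moreover have "linear_relations (ksmul emb smul) V \<union> commutators V \<subseteq> K"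
  proof -
    have "?m u \<in> linear_relations smul UNIV \<union> commutators UNIV"
      if "u \<in> linear_relations (ksmul emb smul) V \<union> commutators V" for u
    proof -
      from that have "u \<in> linear_relations (ksmul emb smul) V \<or> u \<in> commutators V" by blast
      then show ?thesis
        unfolding linear_relations_def[of "ksmul emb smul"] commutators_def[of V]
      proof (elim disjE UnE CollectE exE conjE)
        fix x y assume "u = letter (x + y) - letter x - letter y"
        then have "?m u = letter (x + y) - letter x - letter y" by (simp only: h)
        then show ?thesis unfolding linear_relations_def by blast
      next
        fix c x assume "u = letter (smul (emb c) x) - const c * letter x"
        then have "?m u = letter (smul (emb c) x) - const (emb c) * letter x" by (simp only: h)
        then show ?thesis unfolding linear_relations_def by blast
      next
        fix x y assume "u = letter x * letter y - letter y * letter x"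
        then have "?m u = letter x * letter y - letter y * letter x" by (simp only: h)
        then show ?thesis unfolding commutators_def by blast
      qed
    qed
    then show ?thesis
      using linear_relations_closed[of V "ksmul emb smul"] commutators_closed[of V] V r(2)
        commutators_in_tensor_ideal[of smul e, OF line]
      unfolding K_def by blast
  qed
  ultimately have "sym_ideal (ksmul emb smul) V \<subseteq> K"
    unfolding sym_ideal_def by (rule ring.genideal_minimal[OF ring_free_algebra])
  then show ?thesis using u by (auto simp: K_def)
qed

text \<open>
  The canonical map is defined by all representatives of a class at once; they agree by
  \<open>map_sym_ideal\<close>, so that any single one computes it.
\<close>

lemma canonical_map_coset:
  fixes emb :: "'k::field \<Rightarrow> 'f::field" and smul :: "'f \<Rightarrow> 'w::ab_group_add \<Rightarrow> 'w"
  assumes hom: "emb \<in> ring_hom (ring_of TYPE('k)) (ring_of TYPE('f))"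
    and V: "\<And>x y. x \<in> V \<Longrightarrow> y \<in> V \<Longrightarrow> x + y \<in> V" "\<And>c x. x \<in> V \<Longrightarrow> smul (emb c) x \<in> V"
    and line: "\<And>w. \<exists>a. w = smul a e"
  shows "canonical_map emb smul (sym_ideal (ksmul emb smul) V +>\<^bsub>free_algebra V\<^esub> u)
    = tensor_ideal smul UNIV +>\<^bsub>free_algebra UNIV\<^esub> Poly_Mapping.map emb u"
proof -
  let ?I = "sym_ideal (ksmul emb smul) V" and ?J = "tensor_ideal smul UNIV"
  interpret J: ideal ?J "free_algebra UNIV" by (rule tensor_ideal_rules)
  interpret I: ideal ?I "free_algebra V" by (rule ideal_sym_ideal) (use V in auto)
  note h = map_poly_mapping_hom[OF hom]
  have coset: "?I +>\<^bsub>free_algebra V\<^esub> u = (\<lambda>s. s + u) ` ?I"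
    by (auto simp: a_r_coset_def' image_def)
  have "?J +>\<^bsub>free_algebra UNIV\<^esub> Poly_Mapping.map emb (s + u)
      = ?J +>\<^bsub>free_algebra UNIV\<^esub> Poly_Mapping.map emb u" if "s \<in> ?I" for s
  proof -
    have "Poly_Mapping.map emb s \<in> ?J" by (rule map_sym_ideal[OF hom V line that])
    then have "Poly_Mapping.map emb (s + u) \<in> ?J +>\<^bsub>free_algebra UNIV\<^esub> Poly_Mapping.map emb u"
      by (auto simp: a_r_coset_def' h)
    then show ?thesis by (intro J.a_repr_independence'[symmetric]) auto
  qed
  moreover have "0 \<in> ?I" using additive_subgroup.zero_closed[OF I.additive_subgroup_axioms] by simp
  ultimately have "(\<lambda>u. ?J +>\<^bsub>free_algebra UNIV\<^esub> Poly_Mapping.map emb u) ` (?I +>\<^bsub>free_algebra V\<^esub> u)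
      = {?J +>\<^bsub>free_algebra UNIV\<^esub> Poly_Mapping.map emb u}"
    unfolding coset image_image by force
  then show ?thesis by (simp add: canonical_map_def)
qed

lemma coset_eq_ideal:
  assumes "ideal J R" "u \<in> J" shows "J +>\<^bsub>R\<^esub> u = J"
proof -
  interpret ideal J R by fact
  show ?thesis using assms(2) by (rule a_rcos_const)
qed

section \<open>Holomorphic forms\<close>

text \<open>
  Holomorphic forms are a space over the constants.  The linear relations between them
  therefore lie in the free algebra on them, so that they generate an ideal of it.
\<close>

lemma hol_forms_closed:
  fixes emb :: "'k::field \<Rightarrow> 'f::field" and smul :: "'f \<Rightarrow> 'w::ab_group_add \<Rightarrow> 'w"
  assumes vs: "vector_space smul"
  shows "x \<in> hol_forms emb smul d \<Longrightarrow> y \<in> hol_forms emb smul d \<Longrightarrow> x + y \<in> hol_forms emb smul d"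
    and "x \<in> hol_forms emb smul d \<Longrightarrow> smul (emb c) x \<in> hol_forms emb smul d"
proof -
  note lin = form_of_linear[OF vs, of d]
  show "x + y \<in> hol_forms emb smul d" if xy: "x \<in> hol_forms emb smul d" "y \<in> hol_forms emb smul d"
  proof -
    have "x + y \<in> regular_forms smul d Q" if Q: "place emb Q" for Q
    proof -
      have 0: "0 \<in> local_ring Q" by (simp add: local_ring_def val_ge_def)
      have add: "a + b \<in> local_ring Q" if "a \<in> local_ring Q" "b \<in> local_ring Q" for a b
      proof (cases "a = 0 \<or> b = 0 \<or> a + b = 0")
        case True
        then show ?thesis using that 0 by auto
      next
        case False
        then have "min (Q a) (Q b) \<le> Q (a + b)" using Q unfolding place_def by blast
        then show ?thesis using that False by (auto simp: local_ring_def val_ge_def)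
      qed
      obtain u v where u: "x = form_of smul d u" "\<forall>x\<in>Poly_Mapping.keys u. x \<in> local_ring Q \<and>
          Poly_Mapping.lookup u x \<in> local_ring Q"
        and v: "y = form_of smul d v" "\<forall>x\<in>Poly_Mapping.keys v. x \<in> local_ring Q \<and>
          Poly_Mapping.lookup v x \<in> local_ring Q"
        using xy Q unfolding hol_forms_def regular_forms_def by blast
      have "z \<in> local_ring Q \<and> Poly_Mapping.lookup (u + v) z \<in> local_ring Q" if "z \<in> Poly_Mapping.keys (u + v)" for z
      proof
        show "z \<in> local_ring Q" using that Poly_Mapping.keys_add[of u v] u(2) v(2) by blast
        have "Poly_Mapping.lookup u z \<in> local_ring Q" "Poly_Mapping.lookup v z \<in> local_ring Q"
          using u(2) v(2) 0 by (metis in_keys_iff)+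
        then show "Poly_Mapping.lookup (u + v) z \<in> local_ring Q" by (simp add: lookup_add add)
      qed
      moreover have "x + y = form_of smul d (u + v)" by (simp add: u v lin)
      ultimately show ?thesis unfolding regular_forms_def by blast
    qed
    then show ?thesis by (simp add: hol_forms_def)
  qed
  show "smul (emb c) x \<in> hol_forms emb smul d" if x: "x \<in> hol_forms emb smul d"
  proof -
    have "smul (emb c) x \<in> regular_forms smul d Q" if Q: "place emb Q" for Q
    proof -
      have mult: "emb c * a \<in> local_ring Q" if "a \<in> local_ring Q" for a
      proof (cases "a = 0 \<or> emb c = 0")
        case True
        then show ?thesis by (auto simp: local_ring_def val_ge_def)
      next
        case False
        then have "Q (emb c * a) = Q (emb c) + Q a" "Q (emb c) = 0" using Q unfolding place_def by blast+
        then show ?thesis using that False by (auto simp: local_ring_def val_ge_def)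
      qed
      obtain u where u: "x = form_of smul d u" "\<forall>x\<in>Poly_Mapping.keys u. x \<in> local_ring Q \<and>
          Poly_Mapping.lookup u x \<in> local_ring Q"
        using x Q unfolding hol_forms_def regular_forms_def by blast
      have "smul (emb c) x = form_of smul d (Poly_Mapping.map ((*) (emb c)) u)" by (simp add: u lin)
      moreover have "\<forall>z\<in>Poly_Mapping.keys (Poly_Mapping.map ((*) (emb c)) u). z \<in> local_ring Q \<and>
          Poly_Mapping.lookup (Poly_Mapping.map ((*) (emb c)) u) z \<in> local_ring Q"
        using u(2) mult by (auto simp: in_keys_iff Poly_Mapping.map.rep_eq when_def)
      ultimately show ?thesis unfolding regular_forms_def by blast
    qed
    then show ?thesis by (simp add: hol_forms_def)
  qed
qed

section \<open>Quotients of the free algebra\<close>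

lemma quotient_coset_ops:
  fixes I :: "('w fword \<Rightarrow>\<^sub>0 'r::comm_ring_1) set"
  assumes I: "ideal I (free_algebra V)"
  defines "h \<equiv> (\<lambda>u. I +>\<^bsub>free_algebra V\<^esub> u)" and "Q \<equiv> free_algebra V Quot I"
  shows "u \<in> carrier (free_algebra V) \<Longrightarrow> h u \<in> carrier Q"
    and "u \<in> carrier (free_algebra V) \<Longrightarrow> v \<in> carrier (free_algebra V) \<Longrightarrow>
      h u \<otimes>\<^bsub>Q\<^esub> h v = h (u * v)"
    and "u \<in> carrier (free_algebra V) \<Longrightarrow> v \<in> carrier (free_algebra V) \<Longrightarrow>
      h u \<oplus>\<^bsub>Q\<^esub> h v = h (u + v)"
    and "u \<in> carrier (free_algebra V) \<Longrightarrow> v \<in> carrier (free_algebra V) \<Longrightarrow>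
      h u \<ominus>\<^bsub>Q\<^esub> h v = h (u - v)"
proof -
  interpret R: ring "free_algebra V :: ('w fword \<Rightarrow>\<^sub>0 'r) ring" by (rule ring_free_algebra)
  interpret Q: ring Q unfolding Q_def by (rule ideal.quotient_is_ring[OF I])
  have hom: "h \<in> ring_hom (free_algebra V) Q"
    unfolding h_def Q_def by (rule ideal.rcos_ring_hom[OF I])
  interpret h: ring_hom_ring "free_algebra V" Q h
    by (rule ring_hom_ringI2[OF R.ring_axioms Q.ring_axioms hom])
  show "h u \<in> carrier Q" if "u \<in> carrier (free_algebra V)"
    using that by (rule h.hom_closed)
  show "h u \<otimes>\<^bsub>Q\<^esub> h v = h (u * v)" if "u \<in> carrier (free_algebra V)" "v \<in> carrier (free_algebra V)"
    using h.hom_mult[OF that] by simp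
  show "h u \<oplus>\<^bsub>Q\<^esub> h v = h (u + v)" if "u \<in> carrier (free_algebra V)" "v \<in> carrier (free_algebra V)"
    using h.hom_add[OF that] by simp
  show "h u \<ominus>\<^bsub>Q\<^esub> h v = h (u - v)" if u: "u \<in> carrier (free_algebra V)" and v: "v \<in> carrier (free_algebra V)"
  proof -
    have "h u \<ominus>\<^bsub>Q\<^esub> h v = h u \<oplus>\<^bsub>Q\<^esub> h (- v)"
      using h.hom_a_inv[OF v] by (simp only: a_minus_def a_inv_free_algebra[OF v])
    then show ?thesis
      using h.hom_add[OF u free_algebra_closed(5)[OF v]] by simp
  qed
qed

lemma quotient_coset_sum:
  fixes I :: "('w fword \<Rightarrow>\<^sub>0 'r::comm_ring_1) set"
  assumes I: "ideal I (free_algebra V)" and "finite A"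
    and "\<And>x. x \<in> A \<Longrightarrow> f x \<in> carrier (free_algebra V)"
  shows "(\<Oplus>\<^bsub>free_algebra V Quot I\<^esub>x\<in>A. I +>\<^bsub>free_algebra V\<^esub> f x) = I +>\<^bsub>free_algebra V\<^esub> sum f A"
  using assms(2,3)
proof (induction A rule: finite_induct)
  case empty
  interpret Q: ring "free_algebra V Quot I" by (rule ideal.quotient_is_ring[OF I])
  have "I +>\<^bsub>free_algebra V\<^esub> 0 = I"
    using coset_eq_ideal[OF I, of 0] additive_subgroup.zero_closed[OF ideal.axioms(1)[OF I]] by simp
  then have "\<zero>\<^bsub>free_algebra V Quot I\<^esub> = I +>\<^bsub>free_algebra V\<^esub> 0"
    by (simp add: FactRing_def)
  then show ?case by (simp only: Q.finsum_empty sum.empty)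
next
  case (insert x A)
  interpret Q: ring "free_algebra V Quot I" by (rule ideal.quotient_is_ring[OF I])
  have A: "f y \<in> carrier (free_algebra V)" if "y \<in> insert x A" for y using insert.prems that .
  have "(\<Oplus>\<^bsub>free_algebra V Quot I\<^esub>x\<in>insert x A. I +>\<^bsub>free_algebra V\<^esub> f x)
      = (I +>\<^bsub>free_algebra V\<^esub> f x) \<oplus>\<^bsub>free_algebra V Quot I\<^esub>
        (\<Oplus>\<^bsub>free_algebra V Quot I\<^esub>x\<in>A. I +>\<^bsub>free_algebra V\<^esub> f x)"
    by (rule Q.finsum_insert) (use insert.hyps A quotient_coset_ops(1)[OF I] in blast)+
  also have "\<dots> = (I +>\<^bsub>free_algebra V\<^esub> f x) \<oplus>\<^bsub>free_algebra V Quot I\<^esub> (I +>\<^bsub>free_algebra V\<^esub> sum f A)"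
    by (subst insert.IH) (use A in blast)+
  also have "\<dots> = I +>\<^bsub>free_algebra V\<^esub> (f x + sum f A)"
    by (rule quotient_coset_ops(3)[OF I]) (use A sum_in_free_algebra[of A f V] in blast)+
  also have "f x + sum f A = sum f (insert x A)" by (rule sum.insert[OF insert.hyps, symmetric])
  finally show ?case .
qed

section \<open>The relation coming from an irreducible polynomial\<close>

lemma fmon_add: "fmon H (L + K) = fmon H L * fmon H K"
  by (simp add: fmon_def lookup_add power_add prod.distrib)

lemma fmon_single:
  assumes "i \<le> len H"
  shows "fmon H (Poly_Mapping.single i n) = gen H i ^ n"
proof -
  have "fmon H (Poly_Mapping.single i n) = (\<Prod>\<nu>\<le>len H. if \<nu> = i then gen H i ^ n else 1)"
    unfolding fmon_def by (rule prod.cong) (auto simp: lookup_single when_def)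
  then show ?thesis using assms by simp
qed

text \<open>
  The sum is indexed as in \<open>Gelem\<close>, by decreasing powers.
\<close>

lemma poly_irr_poly:
  "poly (irr_poly H i) x = x ^ (CHAR('k) ^ ndeg H i)
     + (\<Sum>\<nu>\<in>{1..ndeg H i}. emb H (acoef H i (ndeg H i - \<nu>)) * x ^ (CHAR('k) ^ (ndeg H i - \<nu>)))
     - Delem H i"
  for H :: "('k::field, 'f::field, 'w) hkg"
proof -
  have "(\<Sum>\<nu>\<in>{1..ndeg H i}. emb H (acoef H i (ndeg H i - \<nu>)) * x ^ (CHAR('k) ^ (ndeg H i - \<nu>)))
      = (\<Sum>j<ndeg H i. emb H (acoef H i j) * x ^ (CHAR('k) ^ j))"
    by (rule sum.reindex_bij_witness[of _ "\<lambda>j. ndeg H i - j" "\<lambda>\<nu>. ndeg H i - \<nu>"]) auto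
  then show ?thesis by (simp add: irr_poly_def poly_monom poly_sum)
qed

theorem proposition11:
  fixes H :: "('k::alg_closed_field, 'f::field, 'w::ab_group_add) hkg"
    and ch :: "(nat \<Rightarrow>\<^sub>0 nat) \<Rightarrow> (nat \<Rightarrow>\<^sub>0 nat) \<times> (nat \<Rightarrow>\<^sub>0 nat)"
    and v :: "nat \<Rightarrow>\<^sub>0 nat"
    and i :: nat
  assumes "hkg_tower H"
    and "splits H ch"
    and "1 \<le> i" "i \<le> len H"
    and "v \<in> tuples (len H + 1)"
    and "int (tnorm H (gam H v i 0)) \<le> 4 * int (genus (emb H) (smul H) (dif H)) - 4"
    and "\<And>\<nu>. \<nu> \<le> ndeg H i \<Longrightarrow> gam H v i \<nu> \<in> AAset H"
    and "\<And>l. l \<in> Lam H i \<Longrightarrow> dcoef H i l \<noteq> 0 \<Longrightarrow> l + v \<in> AAset H"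
  shows "Gelem H ch v i \<in> canonical_ideal (emb H) (smul H) (dif H)"
proof -
  interpret hkg_tower H by fact
  interpret hkg_cover "emb H" "base H" "pt H" by (rule cover)
  have i: "i \<in> {1..len H}" using assms(3,4) by simp
  define V where "V = hol_forms (emb H) (smul H) (dif H)"
  define I where "I = sym_ideal (ksmul (emb H) (smul H)) V"
  define R where "R = (free_algebra V :: ('w fword \<Rightarrow>\<^sub>0 'k) ring)"
  define J where "J = tensor_ideal (smul H) UNIV"
  define c where "c u = I +>\<^bsub>R\<^esub> u" for u
  define S where "S = {l \<in> Lam H i. dcoef H i l \<noteq> 0}"
  have S_eq: "{l \<in> Lam H i. tnorm H l \<le> CHAR('k) ^ ndeg H i * mbar H i \<and> dcoef H i l \<noteq> 0} = S"
    using D_norm[OF i] by (auto simp: S_def)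
  have finS: "finite S" using D_finite[OF i] by (simp add: S_def)
  have vs: "vector_space (smul H)" using kaehler by (simp add: kaehler_module_def)
  have V: "x \<in> V \<Longrightarrow> y \<in> V \<Longrightarrow> x + y \<in> V" "x \<in> V \<Longrightarrow> smul H (emb H a) x \<in> V" for x y a
    unfolding V_def by (rule hol_forms_closed[OF vs]; assumption)+
  have I: "ideal I R" unfolding I_def R_def by (rule ideal_sym_ideal) (use V in auto)
  interpret Q: ring "R Quot I" by (rule ideal.quotient_is_ring[OF I])
  note ops = quotient_coset_ops[OF I[unfolded R_def], folded R_def, folded c_def]
  have Sym: "SymH0 H = R Quot I"
    by (simp add: sym_forms_def sym_algebra_def I_def R_def V_def)
  have cls: "sym_class H u = c u" for u
    by (simp add: sym_class_def Let_def c_def I_def R_def V_def)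
  note closed = free_algebra_closed[where 'r = 'k and V = V, folded R_def]
  \<comment> \<open>the representative of \<open>\<omega>\<^sub>u\<^sup>\<otimes>\<^sup>2\<close> in the free algebra\<close>
  define W :: "(nat \<Rightarrow>\<^sub>0 nat) \<Rightarrow> 'w fword \<Rightarrow>\<^sub>0 'k" where
    "W u = letter (omega H (fst (ch u))) * letter (omega H (snd (ch u)))" for u
  have om: "letter (omega H (fst (ch u))) \<in> carrier R" "letter (omega H (snd (ch u))) \<in> carrier R"
    if "u \<in> AAset H" for u
  proof -
    have "fst (ch u) \<in> Aset H" "snd (ch u) \<in> Aset H"
      using that assms(2) unfolding splits_def by blast+
    then have "omega H (fst (ch u)) \<in> V" "omega H (snd (ch u)) \<in> V"
      using omega_hol unfolding V_def by blast+
    then show "letter (omega H (fst (ch u))) \<in> carrier R" "letter (omega H (snd (ch u))) \<in> carrier R"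
      by (simp_all only: closed(4))
  qed
  have W: "W u \<in> carrier R" "omega2 H ch u = c (W u)" if "u \<in> AAset H" for u
    by (simp_all only: W_def omega2_def cls Sym ops(2)[OF om[OF that]] closed(8)[OF om[OF that]])
  have cW: "const a * W u \<in> carrier R" "c (const a) \<otimes>\<^bsub>R Quot I\<^esub> omega2 H ch u = c (const a * W u)"
    if "u \<in> AAset H" for u a
    by (simp_all only: W(2)[OF that] ops(2)[OF closed(3) W(1)[OF that]] closed(8)[OF closed(3) W(1)[OF that]])
  define n where "n = ndeg H i"
  define U1 where "U1 = (\<Sum>\<nu>\<in>{1..n}. const (acoef H i (n - \<nu>)) * W (gam H v i \<nu>))"
  define U2 where "U2 = (\<Sum>l\<in>S. const (dcoef H i l) * W (l + v))"
  have gam: "gam H v i \<nu> \<in> AAset H" if "\<nu> \<le> n" for \<nu> using assms(7) that by (simp add: n_def)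
  have S: "l + v \<in> AAset H" if "l \<in> S" for l using assms(8) that by (simp add: S_def)
  have Ucar: "U1 \<in> carrier R" "U2 \<in> carrier R" unfolding U1_def U2_def R_def
    by (rule sum_in_free_algebra; use cW(1) gam S in \<open>auto simp: R_def\<close>)+
  have Gelem: "Gelem H ch v i = c (W (gam H v i 0) + U1 - U2)"
  proof -
    have "(\<Oplus>\<^bsub>R Quot I\<^esub> \<nu>\<in>{1..n}. c (const (acoef H i (n - \<nu>))) \<otimes>\<^bsub>R Quot I\<^esub> omega2 H ch (gam H v i \<nu>))
        = (\<Oplus>\<^bsub>R Quot I\<^esub> \<nu>\<in>{1..n}. c (const (acoef H i (n - \<nu>)) * W (gam H v i \<nu>)))"
      by (rule Q.finsum_cong') (use gam in \<open>auto simp only: cW atLeastAtMost_iff intro: ops(1)\<close>)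
    also have "\<dots> = c U1" unfolding U1_def c_def R_def
      by (rule quotient_coset_sum[OF I[unfolded R_def]]) (use cW(1)[unfolded R_def] gam in auto)
    finally have 1: "(\<Oplus>\<^bsub>R Quot I\<^esub> \<nu>\<in>{1..n}. c (const (acoef H i (n - \<nu>))) \<otimes>\<^bsub>R Quot I\<^esub> omega2 H ch (gam H v i \<nu>)) = c U1" .
    have "(\<Oplus>\<^bsub>R Quot I\<^esub> l\<in>S. c (const (dcoef H i l)) \<otimes>\<^bsub>R Quot I\<^esub> omega2 H ch (l + v))
        = (\<Oplus>\<^bsub>R Quot I\<^esub> l\<in>S. c (const (dcoef H i l) * W (l + v)))"
      by (rule Q.finsum_cong') (use S in \<open>auto simp only: cW intro: ops(1)\<close>)
    also have "\<dots> = c U2" unfolding U2_def c_def R_def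
      by (rule quotient_coset_sum[OF I[unfolded R_def] finS]) (use cW(1)[unfolded R_def] S in blast)
    finally have 2: "(\<Oplus>\<^bsub>R Quot I\<^esub> l\<in>S. c (const (dcoef H i l)) \<otimes>\<^bsub>R Quot I\<^esub> omega2 H ch (l + v)) = c U2" .
    show ?thesis unfolding Gelem_def S_eq unfolding Sym cls n_def[symmetric] 1 2
      using W[OF gam] Ucar by (simp add: ops closed(6))
  qed
  have Ucar': "W (gam H v i 0) + U1 - U2 \<in> carrier R"
    using W(1)[OF gam] Ucar by (intro closed) auto
  have "Gelem H ch v i \<in> carrier (SymH0 H)"
    unfolding Gelem Sym by (rule ops(1)[OF Ucar'])
  moreover have "canonical_map (emb H) (smul H) (Gelem H ch v i) = J"
  proof -
    obtain e where e: "\<And>w. \<exists>a. w = smul H a e"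
      using differentials_one_dimensional[OF cover kaehler] by metis
    note h = map_poly_mapping_hom[OF emb_hom] ring_hom_ring_of[OF emb_hom]
    note r = tensor_ideal_rules[where smul = "smul H", folded J_def]
    let ?m = "Poly_Mapping.map (emb H)"
    define T where "T = letter (dif H (gen H 0)) * (letter (dif H (gen H 0)) :: 'w fword \<Rightarrow>\<^sub>0 'f)"
    \<comment> \<open>\<open>M x a\<close> says that \<open>x\<close> and \<open>a df\<^sub>0 \<otimes> df\<^sub>0\<close> are the same tensor; such pairs \<open>(x, a)\<close>
      form a vector space over the function field\<close>
    define M where "M x a \<longleftrightarrow> x - const a * T \<in> J" for x and a :: 'f
    have M_add: "M (x + y) (a + b)" if "M x a" "M y b" for x y a b
      using r(4)[OF that[unfolded M_def]] by (simp add: M_def single_add algebra_simps)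
    have M_diff: "M (x - y) (a - b)" if "M x a" "M y b" for x y a b
      using r(5)[OF that[unfolded M_def]] by (simp add: M_def single_diff algebra_simps)
    have M_const: "M (const b * x) (b * a)" if "M x a" for x a b
      using r(7)[OF that[unfolded M_def], of "const b"]
      by (simp add: M_def right_diff_distrib mult_single mult.assoc[symmetric])
    have M_sum: "M (sum f A) (sum g A)" if "\<And>x. x \<in> A \<Longrightarrow> M (f x) (g x)" for f g and A :: "'z set"
      using that
      by (induction A rule: infinite_finite_induct) (auto simp: M_add, auto simp: M_def r(3))
    have M_W: "M (?m (W u)) (fmon H u)" if "u \<in> AAset H" for u
    proof -
      have "fmon H u = fmon H (fst (ch u)) * fmon H (snd (ch u))"
        using that assms(2) by (metis fmon_add splits_def)
      then show ?thesis
        using letter_smul_times_cong[of "smul H" "fmon H (fst (ch u))" "dif H (gen H 0)" "fmon H (snd (ch u))"]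
        by (simp add: M_def W_def h omega_def T_def J_def)
    qed
    have fgam: "fmon H (gam H v i \<nu>) = fmon H v * gen H i ^ (CHAR('k) ^ (n - \<nu>))" for \<nu>
      using assms(4) by (simp add: gam_def fmon_add fmon_single n_def)
    define a where "a \<nu> = emb H (acoef H i (n - \<nu>))" for \<nu>
    have "M (?m (W (gam H v i 0) + U1 - U2))
       (fmon H (gam H v i 0) + (\<Sum>\<nu>\<in>{1..n}. a \<nu> * fmon H (gam H v i \<nu>))
         - (\<Sum>l\<in>S. emb H (dcoef H i l) * fmon H (l + v)))"
      unfolding h U1_def U2_def a_def
      by (intro M_add M_diff M_sum M_const M_W gam S) auto
    \<comment> \<open>all monomials share the factor \<open>f\<^sub>v\<close>, and the rest is the irreducible polynomial of \<open>f\<^sub>i\<close>\<close>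
    moreover have "fmon H (gam H v i 0) + (\<Sum>\<nu>\<in>{1..n}. a \<nu> * fmon H (gam H v i \<nu>))
         - (\<Sum>l\<in>S. emb H (dcoef H i l) * fmon H (l + v))
         = fmon H v * poly (irr_poly H i) (gen H i)"
      by (simp add: poly_irr_poly Delem_def fgam fmon_add n_def[symmetric] a_def[symmetric]
          S_def[symmetric] sum_distrib_left algebra_simps)
    ultimately have "?m (W (gam H v i 0) + U1 - U2) \<in> J"
      by (simp add: irr(2)[OF i] M_def)
    then have "J +>\<^bsub>free_algebra UNIV\<^esub> ?m (W (gam H v i 0) + U1 - U2) = J"
      by (rule coset_eq_ideal[OF r(1)])
    moreover have "canonical_map (emb H) (smul H) (Gelem H ch v i)
        = J +>\<^bsub>free_algebra UNIV\<^esub> ?m (W (gam H v i 0) + U1 - U2)"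
      unfolding Gelem c_def I_def R_def J_def
      by (rule canonical_map_coset[where e = e]) (use emb_hom V e in blast)+
    ultimately show ?thesis by simp
  qed
  ultimately show ?thesis
    by (simp add: canonical_ideal_def a_kernel_def' canonical_ring_def tensor_algebra_def
        FactRing_def J_def)
qed

end
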